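(* Let $0<\alpha<1$, $\beta>0$, $y(x)=x^\beta$, and let $t>0$ be fixed. For integers $n\ge3$ let $h=t/n$ and $y_k=y(kh)$. Then, as $n\to\infty$ (with $nh=t$), $$\frac{1}{2\Gamma(1-\alpha)h^\alpha}\left(y_n+\frac{y_{n-1}}{2^\alpha}+\sum_{k=2}^{n-1}\left(\frac{1}{(k+1)^{\alpha}}-\frac{1}{(k-1)^{\alpha}} \right)y_{n-k}\right)=y_n^{(\alpha)}+\frac{\zeta(\alpha)}{\Gamma(1-\alpha)}y'_n h^{1-\alpha}+\frac{\zeta(-\beta)}{\Gamma(-\alpha)t^{1+\alpha}}h^{1+\beta}+O\left(h^{2-\alpha}\right).$$
   Context: $\zeta$ is the Riemann zeta function (analytically continued). $y_n=y(t)$, $y'_n=y'(t)=\beta t^{\beta-1}$, and $y_n^{(\alpha)}=y^{(\alpha)}(t)$ is the Caputo derivative $y^{(\alpha)}(t)=\frac{1}{\Gamma(1-\alpha)}\int_0^t \frac{y'(x)}{(t-x)^\alpha}\,dx$, which for $y(x)=x^\beta$ equals $\frac{\Gamma(1+\beta)}{\Gamma(1+\beta-\alpha)}t^{\beta-\alpha}$. *)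

theory Defs
  imports "HOL-Complex_Analysis.Complex_Analysis" "HOL-Library.Landau_Symbols"
begin

text \<open>
  The Riemann zeta function as the analytic continuation of its Dirichlet series to the plane
  without the pole at 1. The dummy value at the pole makes the description unique (the rest is
  determined by the identity theorem).
\<close>
definition zeta :: "complex \<Rightarrow> complex" where
  "zeta = (THE f. f holomorphic_on (- {1}) \<and>
             (\<forall>s. Re s > 1 \<longrightarrow> (\<lambda>n. 1 / of_nat (Suc n) powr s) sums f s) \<and>
             f 1 = 0)"

text \<open>
  At the endpoints of the interval the integrand takes irrelevant dummy values
  (\<^term>\<open>1 / 0 = (0::real)\<close> at the upper one, possibly an unspecified \<^const>\<open>deriv\<close> at 0);
  these do not affect the integral.
\<close>
definition caputo :: "real \<Rightarrow> (real \<Rightarrow> real) \<Rightarrow> real \<Rightarrow> real" where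
  "caputo \<alpha> y t =
     1 / Gamma (1 - \<alpha>) * integral {0..t} (\<lambda>x. deriv y x / (t - x) powr \<alpha>)"

end

theory Submission imports Defs begin

text \<open>
  Summation by parts turns the left-hand side into
  \<open>\<Sum>\<^sub>k (q(k) + q(k+1)) ((k+1)\<^sup>\<beta> - k\<^sup>\<beta>)\<close> with \<open>q(x) = (n - x)\<^sup>-\<^sup>\<alpha>\<close>, up to the factor
  \<open>h\<^sup>\<beta>\<^sup>-\<^sup>\<alpha> / (2 \<Gamma>(1 - \<alpha>))\<close>. Its difference from twice the Beta integral \<open>\<integral> \<beta> x\<^sup>\<beta>\<^sup>-\<^sup>1 q(x) dx\<close> over
  \<open>[0, n]\<close> is the sum over the unit cells of the integrals of \<open>\<beta> x\<^sup>\<beta>\<^sup>-\<^sup>1\<close> against the trapezoidal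
  defect \<open>q(k) + q(k+1) - 2 q(x)\<close>, which is small and nearly of mean zero. Near \<open>x = n\<close> the smooth
  factor may be frozen at its value at \<open>n\<close>, and the means of the defects add up to \<open>2 \<zeta>(\<alpha>)\<close>. Near
  \<open>x = 0\<close> the linear part of \<open>q\<close> produces \<open>\<zeta>(-\<beta>)\<close>; this matters only for \<open>\<beta> < 1\<close>, since for
  \<open>\<beta> \<ge> 1\<close> the term \<open>h\<^sup>1\<^sup>+\<^sup>\<beta>\<close> is absorbed by the error. Both zeta values thus have argument
  in \<open>(-1, 1)\<close>, where zeta is the limit of \<open>\<Sum>k\<^sup>-\<^sup>s - N\<^sup>-\<^sup>s/2 - N\<^sup>1\<^sup>-\<^sup>s/(1 - s)\<close> over \<open>k \<le> N\<close>.

  The analytic continuation of zeta, one half-plane at a time, comes from summing the binomial expansion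
  of \<open>(n + 1)\<^sup>1\<^sup>-\<^sup>s - n\<^sup>1\<^sup>-\<^sup>s\<close>, whose left-hand side telescopes.
\<close>

section \<open>Analytic continuation of the zeta function\<close>

lemma holomorphic_on_suminf_M_test:
  fixes f :: "nat \<Rightarrow> complex \<Rightarrow> complex"
  assumes "open S" and hol: "\<And>n. f n holomorphic_on S"
    and M: "\<And>x. x \<in> S \<Longrightarrow> \<exists>d>0. cball x d \<subseteq> S \<and>
       (\<exists>M. summable M \<and> (\<forall>n. \<forall>z\<in>cball x d. norm (f n z) \<le> M n))"
  shows "(\<lambda>z. \<Sum>n. f n z) holomorphic_on S"
proof (rule holomorphic_uniform_sequence[OF \<open>open S\<close>])
  show "(\<lambda>z. \<Sum>i<n. f i z) holomorphic_on S" for n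
    by (intro holomorphic_intros hol)
next
  fix x assume "x \<in> S"
  then obtain d M where d: "d > 0" "cball x d \<subseteq> S" "summable M"
    "\<And>n z. z \<in> cball x d \<Longrightarrow> norm (f n z) \<le> M n"
    using M by metis
  then have "uniform_limit (cball x d) (\<lambda>n z. \<Sum>i<n. f i z) (\<lambda>z. \<Sum>n. f n z) sequentially"
    by (intro Weierstrass_m_test[of _ _ M]) auto
  then show "\<exists>d>0. cball x d \<subseteq> S \<and>
      uniform_limit (cball x d) (\<lambda>n z. \<Sum>i<n. f i z) (\<lambda>z. \<Sum>n. f n z) sequentially"
    using d by blast
qed

text \<open>Remainder of the binomial expansion of (n + 1)^a in descending powers of n, cut after
  order K.\<close>

definition binom_rem :: "nat \<Rightarrow> complex \<Rightarrow> nat \<Rightarrow> complex" where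
  "binom_rem K a n = of_nat (Suc n) powr a - (\<Sum>k\<le>K. (a gchoose k) * of_nat n powr (a - of_nat k))"

text \<open>The i-th factor a - i of the falling factorial has norm at most r + i. The resulting
  bound is uniform over a disc of exponents and controls the derivatives in Taylor's theorem
  below.\<close>

lemma norm_fact_gbinomial_le:
  fixes a :: complex
  assumes "norm a \<le> r"
  shows "norm (fact k * (a gchoose k)) \<le> (\<Prod>i=0..<k. r + real i)"
proof -
  have "norm (fact k * (a gchoose k)) = (\<Prod>i=0..<k. norm (a - of_nat i))"
    by (simp add: gbinomial_mult_fact prod_norm)
  also have "\<dots> \<le> (\<Prod>i=0..<k. r + real i)"
  proof (intro prod_mono conjI)
    fix i
    show "norm (a - of_nat i) \<le> r + real i"
      using norm_triangle_ineq4[of a "of_nat i"] assms by simp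
  qed auto
  finally show ?thesis .
qed

text \<open>Dividing by n^a turns the remainder into the Taylor remainder of z^a about 1, taken at z
  = 1 + 1/n. Apart from Re a, the bound depends on a only through r, so it serves a whole
  disc.\<close>

lemma norm_binom_rem_le:
  assumes "norm a \<le> r" and "n \<ge> 1"
  shows "norm (binom_rem K a n) \<le>
    ((\<Prod>i=0..<Suc K. r + real i) * 2 powr r / fact K) * real n powr (Re a - real (Suc K))"
proof -
  define f where "f = (\<lambda>i z. fact i * (a gchoose i) * z powr (a - of_nat i))"
  define B where "B = (\<Prod>i=0..<Suc K. r + real i) * 2 powr r"
  define S where "S = closed_segment (1::complex) 2"
  have S: "z \<in> \<real> \<and> 1 \<le> Re z \<and> Re z \<le> 2" if "z \<in> S" for z
    using that unfolding S_def closed_segment_def by (auto simp: complex_is_Real_iff)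
  have r0: "r \<ge> 0" using assms(1) norm_ge_zero order_trans by blast
  \<comment> \<open>This point lies on the segment from 1 to 2 for every n \<ge> 1, so one
    derivative bound on that segment serves all n.\<close>
  define w :: complex where "w = 1 + 1 / of_nat n"
  have n0: "n > 0" using assms by simp
  have "w = (1 - 1 / real n) *\<^sub>R 1 + (1 / real n) *\<^sub>R 2"
    by (simp add: w_def scaleR_conv_of_real)
  moreover have "0 \<le> 1 / real n" "1 / real n \<le> 1" using n0 by auto
  ultimately have wS: "w \<in> S" unfolding S_def closed_segment_def by blast
  have "norm (f 0 w - (\<Sum>i\<le>K. f i 1 * (w - 1) ^ i / fact i)) \<le> B * norm (w - 1) ^ Suc K / fact K"
  proof (rule complex_Taylor)
    show "convex S" "1 \<in> S" "w \<in> S" using wS by (auto simp: S_def)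
    fix i z assume z: "z \<in> S"
    then have nz: "z \<notin> \<real>\<^sub>\<le>\<^sub>0" using S[OF z] by (auto simp: complex_nonpos_Reals_iff)
    have "fact (Suc i) * (a gchoose Suc i) = fact i * (a gchoose i) * (a - of_nat i)"
      unfolding gbinomial_mult_fact by simp
    moreover have "(f i has_field_derivative
        fact i * (a gchoose i) * ((a - of_nat i) * z powr (a - of_nat i - 1))) (at z within S)"
      unfolding f_def using nz
      by (intro DERIV_cmult has_field_derivative_at_within[OF has_field_derivative_powr])
    moreover have "a - of_nat i - 1 = a - of_nat (Suc i)" by simp
    ultimately show "(f i has_field_derivative f (Suc i) z) (at z within S)"
      unfolding f_def by (simp only: mult.assoc)
  next
    fix z assume z: "z \<in> S"
    have "norm (z powr (a - of_nat (Suc K))) = Re z powr (Re a - real (Suc K))"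
      using S[OF z] by (subst norm_powr_real_powr) auto
    also have "\<dots> \<le> Re z powr r"
      using S[OF z] assms(1) complex_Re_le_cmod[of a] by (intro powr_mono) auto
    also have "\<dots> \<le> 2 powr r"
      using S[OF z] r0 by (intro powr_mono2) auto
    finally have "norm (z powr (a - of_nat (Suc K))) \<le> 2 powr r" .
    then show "norm (f (Suc K) z) \<le> B"
      unfolding f_def B_def norm_mult[of _ "z powr _"]
      by (intro mult_mono norm_fact_gbinomial_le[OF assms(1)] prod_nonneg) (auto simp: r0)
  qed
  also have "norm (w - 1) ^ Suc K = real n powr (- real (Suc K))"
    using n0 by (simp add: w_def norm_divide powr_minus powr_realpow power_one_over field_simps del: power_Suc of_nat_Suc)
  finally have *: "norm (f 0 w - (\<Sum>i\<le>K. f i 1 * (w - 1) ^ i / fact i))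
    \<le> B * real n powr (- real (Suc K)) / fact K" .
  have "binom_rem K a n = of_nat n powr a * (f 0 w - (\<Sum>i\<le>K. f i 1 * (w - 1) ^ i / fact i))"
  proof -
    have "of_nat (Suc n) = of_nat n * w" using n0 by (simp add: w_def field_simps)
    moreover have "(of_nat n * w) powr a = of_nat n powr a * w powr a"
      by (rule powr_times_real_left) auto
    moreover have "of_nat n powr (a - of_nat i) = of_nat n powr a * (w - 1) ^ i" for i
      using n0 by (simp add: powr_diff w_def powr_nat' power_one_over field_simps)
    ultimately show ?thesis
      by (simp add: binom_rem_def f_def algebra_simps sum_distrib_left)
  qed
  then have "norm (binom_rem K a n) = real n powr Re a * norm (f 0 w - (\<Sum>i\<le>K. f i 1 * (w - 1) ^ i / fact i))"
    using n0 by (simp add: norm_mult norm_powr_real_powr)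
  also have "\<dots> \<le> real n powr Re a * (B * real n powr (- real (Suc K)) / fact K)"
    using * by (intro mult_left_mono) auto
  also have "\<dots> = B / fact K * real n powr (Re a - real (Suc K))"
    using powr_add[of "real n" "Re a" "- real (Suc K)"] by (simp add: field_simps)
  finally show ?thesis by (simp add: B_def)
qed

lemma summable_Suc_powr:
  assumes "\<rho> < -1"
  shows "summable (\<lambda>n. real (Suc n) powr \<rho>)"
  using assms by (subst summable_Suc_iff[of "\<lambda>n. real n powr \<rho>"]) (simp add: summable_real_powr_iff)

text \<open>The exponent \<rho> - (K + 1) is below -1, so the majorant is summable. It depends on r
  and \<rho> but not on a, as the M-test requires.\<close>

lemma binom_rem_uniform_bound:
  assumes "\<rho> < real K"
  obtains M where "summable M"
    "\<And>a n. norm a \<le> r \<Longrightarrow> Re a \<le> \<rho> \<Longrightarrow> norm (binom_rem K a (Suc n)) \<le> M n"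
proof
  define C where "C = (\<Prod>i=0..<Suc K. r + real i) * 2 powr r / fact K"
  show "summable (\<lambda>n. \<bar>C\<bar> * real (Suc n) powr (\<rho> - real (Suc K)))"
    using assms by (intro summable_mult summable_Suc_powr) auto
  fix a n assume a: "norm a \<le> r" "Re a \<le> \<rho>"
  have "norm (binom_rem K a (Suc n)) \<le> C * real (Suc n) powr (Re a - real (Suc K))"
    unfolding C_def using a by (intro norm_binom_rem_le) auto
  also have "\<dots> \<le> \<bar>C\<bar> * real (Suc n) powr (\<rho> - real (Suc K))"
    using a by (intro mult_mono powr_mono) auto
  finally show "norm (binom_rem K a (Suc n)) \<le> \<bar>C\<bar> * real (Suc n) powr (\<rho> - real (Suc K))" .
qed

lemma summable_binom_rem:
  assumes "Re a < real K"
  shows "summable (\<lambda>n. binom_rem K a (Suc n))"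
proof -
  obtain M where M: "summable M"
    "\<And>b n. norm b \<le> norm a \<Longrightarrow> Re b \<le> Re a \<Longrightarrow> norm (binom_rem K b (Suc n)) \<le> M n"
    using binom_rem_uniform_bound[OF assms, of "norm a"] by blast
  show ?thesis using M(1) by (rule summable_comparison_test') (rule M(2), auto)
qed

lemma holomorphic_suminf_binom_rem:
  "(\<lambda>a. \<Sum>n. binom_rem K a (Suc n)) holomorphic_on {a. Re a < real K}"
proof (rule holomorphic_on_suminf_M_test)
  show "open {a. Re a < real K}" by (rule open_halfspace_Re_lt)
  show "(\<lambda>a. binom_rem K a (Suc n)) holomorphic_on {a. Re a < real K}" for n
    unfolding binom_rem_def gbinomial_prod_rev
    by (intro holomorphic_intros) (auto simp del: of_nat_Suc)
  fix x :: complex assume x: "x \<in> {a. Re a < real K}"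
  \<comment> \<open>Half the distance to the line Re a = K, so that real parts on the closed disc
    stay below K by a fixed margin.\<close>
  define d where "d = (real K - Re x) / 2"
  have d: "d > 0" "Re x + d < real K" using x by (auto simp: d_def field_simps)
  obtain M where M: "summable M"
    "\<And>a n. norm a \<le> norm x + d \<Longrightarrow> Re a \<le> Re x + d \<Longrightarrow> norm (binom_rem K a (Suc n)) \<le> M n"
    using binom_rem_uniform_bound[OF d(2), of "norm x + d"] by blast
  have *: "norm z \<le> norm x + d \<and> Re z \<le> Re x + d" if "z \<in> cball x d" for z
    using that norm_triangle_ineq[of x "z - x"] complex_Re_le_cmod[of "z - x"]
    by (auto simp: dist_norm norm_minus_commute)
  show "\<exists>d>0. cball x d \<subseteq> {a. Re a < real K} \<and>
       (\<exists>M. summable M \<and> (\<forall>n. \<forall>z\<in>cball x d. norm (binom_rem K z (Suc n)) \<le> M n))"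
    using d M * by (intro exI[of _ d] conjI exI[of _ M]) force+
qed

lemma summable_dirichlet:
  assumes "Re s > 1"
  shows "summable (\<lambda>n. 1 / of_nat (Suc n) powr s :: complex)"
proof (rule summable_norm_cancel)
  have "norm (1 / of_nat (Suc n) powr s) = real (Suc n) powr (- Re s)" for n
    by (simp add: norm_divide norm_powr_real_powr powr_minus_divide del: of_nat_Suc)
  then show "summable (\<lambda>n. norm (1 / of_nat (Suc n) powr s))"
    using summable_Suc_powr[of "- Re s"] assms by simp
qed

lemma of_nat_powr_tendsto_0:
  fixes a :: complex
  assumes "Re a < 0"
  shows "(\<lambda>n. of_nat (Suc n) powr a) \<longlonglongrightarrow> 0"
proof (rule tendsto_norm_zero_cancel)
  have "(\<lambda>n. real (Suc n) powr Re a) \<longlonglongrightarrow> 0"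
    using assms by (intro tendsto_neg_powr filterlim_compose[OF filterlim_real_sequentially filterlim_Suc])
  then show "(\<lambda>n. norm (of_nat (Suc n) powr a)) \<longlonglongrightarrow> 0"
    by (simp add: norm_powr_real_powr del: of_nat_Suc)
qed

text \<open>The expansion of (n + 1)^(1 - s) - n^(1 - s) is summed over n \<ge> 1. The left side
  telescopes to -1, the term k = 1 gives (1 - s) \<zeta>(s), and all other zeta values are shifted
  to the right by at least 1. The remainder series converges for Re s > -K, hence its use for
  continuation.\<close>

lemma dirichlet_binomial_recursion:
  assumes s: "Re s > 1"
  defines "\<zeta> \<equiv> (\<lambda>s. \<Sum>n. 1 / of_nat (Suc n) powr s :: complex)"
  shows "(s - 1) * \<zeta> s = 1 + (\<Sum>n. binom_rem (Suc K) (1 - s) (Suc n))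
     + (\<Sum>k=2..Suc K. ((1 - s) gchoose k) * \<zeta> (s + of_nat k - 1))"
proof -
  have z: "(\<lambda>n. of_nat (Suc n) powr (1 - s - of_nat k)) sums \<zeta> (s + of_nat k - 1)" if "k \<ge> 1" for k
  proof -
    have "(\<lambda>n. 1 / of_nat (Suc n) powr (s + of_nat k - 1)) sums \<zeta> (s + of_nat k - 1)"
      unfolding \<zeta>_def using s that by (intro summable_sums summable_dirichlet) auto
    moreover have "1 / of_nat (Suc n) powr (s + of_nat k - 1) = of_nat (Suc n) powr (1 - s - of_nat k)" for n
      using powr_minus_divide[of "of_nat (Suc n) :: complex" "s + of_nat k - 1"] by (simp add: algebra_simps)
    ultimately show ?thesis by simp
  qed
  have "(\<lambda>n. of_nat (Suc (Suc n)) powr (1 - s) - of_nat (Suc n) powr (1 - s)) sums (0 - of_nat (Suc 0) powr (1 - s))"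
    using s by (intro telescope_sums of_nat_powr_tendsto_0) auto
  moreover have "(\<lambda>n. \<Sum>k=1..Suc K. ((1 - s) gchoose k) * of_nat (Suc n) powr (1 - s - of_nat k))
     sums (\<Sum>k=1..Suc K. ((1 - s) gchoose k) * \<zeta> (s + of_nat k - 1))"
    by (intro sums_sum sums_mult z) auto
  ultimately have "(\<lambda>n. (of_nat (Suc (Suc n)) powr (1 - s) - of_nat (Suc n) powr (1 - s)) -
      (\<Sum>k=1..Suc K. ((1 - s) gchoose k) * of_nat (Suc n) powr (1 - s - of_nat k)))
     sums ((0 - of_nat (Suc 0) powr (1 - s)) - (\<Sum>k=1..Suc K. ((1 - s) gchoose k) * \<zeta> (s + of_nat k - 1)))"
    by (rule sums_diff)
  moreover have "binom_rem (Suc K) (1 - s) (Suc n) = (of_nat (Suc (Suc n)) powr (1 - s) - of_nat (Suc n) powr (1 - s)) -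
      (\<Sum>k=1..Suc K. ((1 - s) gchoose k) * of_nat (Suc n) powr (1 - s - of_nat k))" for n
    unfolding binom_rem_def atMost_atLeast0
    by (subst sum.atLeast_Suc_atMost[of 0]) (auto simp del: sum.cl_ivl_Suc of_nat_Suc)
  ultimately have "(\<Sum>n. binom_rem (Suc K) (1 - s) (Suc n)) =
     - 1 - (\<Sum>k=1..Suc K. ((1 - s) gchoose k) * \<zeta> (s + of_nat k - 1))"
    by (simp add: sums_iff)
  also have "(\<Sum>k=1..Suc K. ((1 - s) gchoose k) * \<zeta> (s + of_nat k - 1)) =
     (1 - s) * \<zeta> s + (\<Sum>k=2..Suc K. ((1 - s) gchoose k) * \<zeta> (s + of_nat k - 1))"
    by (subst sum.atLeast_Suc_atMost) (auto simp: numeral_2_eq_2)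
  finally show ?thesis by (simp add: algebra_simps)
qed

text \<open>The last factor cancels the pole of \<open>\<zeta>(s + k - 1)\<close>.\<close>

lemma gbinomial_eq_mult_zeta_pole_factor:
  fixes s :: complex
  assumes "k \<ge> 2"
  shows "((1 - s) gchoose k) = - (((1 - s) gchoose (k - 1)) / of_nat k) * (s + of_nat k - 1 - 1)"
proof -
  obtain j where k: "k = Suc j" using assms by (cases k) auto
  have "fact k * ((1 - s) gchoose k) = fact j * ((1 - s) gchoose j) * (1 - s - of_nat j)"
    unfolding gbinomial_mult_fact k by simp
  then have "fact j * (of_nat k * ((1 - s) gchoose k)) = fact j * (((1 - s) gchoose j) * (1 - s - of_nat j))"
    by (simp add: k algebra_simps)
  then have "of_nat k * ((1 - s) gchoose k) = ((1 - s) gchoose j) * (1 - s - of_nat j)"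
    using mult_left_cancel[of "fact j :: complex"] by simp
  then have "((1 - s) gchoose k) = (((1 - s) gchoose j) * (1 - s - of_nat j)) / of_nat k"
    using assms by (subst nonzero_eq_divide_eq) (auto simp: mult.commute)
  moreover have "s + of_nat k - 1 - 1 = - (1 - s - of_nat j)" by (simp add: k)
  moreover have "k - 1 = j" by (simp add: k)
  ultimately show ?thesis by (simp only: minus_mult_minus times_divide_eq_left)
qed

text \<open>The function continued is (s - 1) \<zeta>(s), which has no pole. Each induction step
  gains a strip of width 1 through the recursion. At the first step the sum over k is empty, so
  holomorphy on Re s > 0 comes from the remainder series alone; this is why K = 0 claims no
  holomorphy.\<close>

lemma dirichlet_continuation_halfplane:
  defines "\<zeta> \<equiv> (\<lambda>s. \<Sum>n. 1 / of_nat (Suc n) powr s :: complex)"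
  shows "\<exists>Z. (K > 0 \<longrightarrow> Z holomorphic_on {s. Re s > 1 - real K}) \<and> (\<forall>s. Re s > 1 \<longrightarrow> Z s = (s - 1) * \<zeta> s)"
proof (induction K)
  case 0
  show ?case by (intro exI[of _ "\<lambda>s. (s - 1) * \<zeta> s"]) simp
next
  case (Suc K)
  then obtain Z where Z: "K > 0 \<longrightarrow> Z holomorphic_on {s. Re s > 1 - real K}"
    "\<And>s. Re s > 1 \<Longrightarrow> Z s = (s - 1) * \<zeta> s"
    by blast
  \<comment> \<open>The right side of the recursion, with the pole factor of each binomial
    coefficient absorbed into Z at a point at least one unit further right.\<close>
  define Z' where "Z' = (\<lambda>s. 1 + (\<Sum>n. binom_rem (Suc K) (1 - s) (Suc n))
     - (\<Sum>k=2..Suc K. ((1 - s) gchoose (k - 1)) / of_nat k * Z (s + of_nat k - 1)))"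
  have "Z' holomorphic_on {s. Re s > 1 - real (Suc K)}"
  proof -
    have 1: "((\<lambda>a. \<Sum>n. binom_rem (Suc K) a (Suc n)) \<circ> (\<lambda>s. 1 - s)) holomorphic_on {s. Re s > 1 - real (Suc K)}"
      by (intro holomorphic_on_compose_gen[OF _ holomorphic_suminf_binom_rem] holomorphic_intros) auto
    have 2: "(Z \<circ> (\<lambda>s. s + of_nat k - 1)) holomorphic_on {s. Re s > 1 - real (Suc K)}"
      if "k \<in> {2..Suc K}" for k
    proof (rule holomorphic_on_compose_gen)
      show "Z holomorphic_on {s. Re s > 1 - real K}" using that Z by auto
    qed (use that in \<open>auto intro!: holomorphic_intros\<close>)
    show ?thesis
      unfolding Z'_def gbinomial_prod_rev using 1 2
      by (intro holomorphic_intros) (auto simp: o_def)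
  qed
  moreover have "Z' s = (s - 1) * \<zeta> s" if s: "Re s > 1" for s
  proof -
    have "((1 - s) gchoose k) * \<zeta> (s + of_nat k - 1) =
       - (((1 - s) gchoose (k - 1)) / of_nat k * Z (s + of_nat k - 1))" if "k \<in> {2..Suc K}" for k
      using that s by (subst Z(2), simp, subst gbinomial_eq_mult_zeta_pole_factor) auto
    then have "(\<Sum>k=2..Suc K. ((1 - s) gchoose k) * \<zeta> (s + of_nat k - 1)) =
       - (\<Sum>k=2..Suc K. ((1 - s) gchoose (k - 1)) / of_nat k * Z (s + of_nat k - 1))"
      unfolding sum_negf[symmetric] by (intro sum.cong) auto
    then show ?thesis
      unfolding Z'_def \<zeta>_def dirichlet_binomial_recursion[OF s, of K] by simp
  qed
  ultimately show ?case by blast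
qed

text \<open>The half-planes are nested and exhaust the plane. By the identity theorem the
  continuations agree on overlaps, so they glue to an entire function.\<close>

lemma dirichlet_continuation:
  obtains F :: "complex \<Rightarrow> complex" where "F holomorphic_on UNIV"
    "\<And>s. Re s > 1 \<Longrightarrow> F s = (s - 1) * (\<Sum>n. 1 / of_nat (Suc n) powr s)"
proof -
  define H where "H = (\<lambda>K. {s. Re s > - real K})"
  have H: "open (H K)" "connected (H K)" for K
    unfolding H_def
    by (auto intro: open_halfspace_Re_gt convex_connected convex_halfspace_Re_gt)
  have "\<forall>K. \<exists>Z. Z holomorphic_on H K \<and>
      (\<forall>s. Re s > 1 \<longrightarrow> Z s = (s - 1) * (\<Sum>n. 1 / of_nat (Suc n) powr s))"
  proof
    fix K
    show "\<exists>Z. Z holomorphic_on H K \<and>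
      (\<forall>s. Re s > 1 \<longrightarrow> Z s = (s - 1) * (\<Sum>n. 1 / of_nat (Suc n) powr s))"
      using dirichlet_continuation_halfplane[of "Suc K"] by (auto simp: H_def)
  qed
  then obtain Z where Z: "\<And>K. Z K holomorphic_on H K"
      "\<And>K s. Re s > 1 \<Longrightarrow> Z K s = (s - 1) * (\<Sum>n. 1 / of_nat (Suc n) powr s)"
    by metis
  have mono: "H K \<subseteq> H L" if "K \<le> L" for K L using that by (auto simp: H_def)
  have agree: "Z K s = Z L s" if "K \<le> L" "s \<in> H K" for K L s
  proof (rule analytic_continuation_open[where f = "Z K" and g = "Z L" and s = "{s. Re s > 1}" and s' = "H K"])
    show "{s. Re s > 1} \<noteq> {}" by (auto intro!: exI[of _ 2])
    show "Z L holomorphic_on H K" using Z(1) mono[OF that(1)] holomorphic_on_subset by blast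
  qed (use H Z that in \<open>auto simp: H_def open_halfspace_Re_gt\<close>)
  \<comment> \<open>The index picks some half-plane that contains s; by \<open>agree\<close> the
    choice does not affect the value.\<close>
  define F where "F = (\<lambda>s. Z (nat \<lceil>1 - Re s\<rceil>) s)"
  have in_H: "s \<in> H (nat \<lceil>1 - Re s\<rceil>)" for s
    unfolding H_def by (simp, linarith)
  have F: "F s = Z K s" if "s \<in> H K" for K s
    unfolding F_def using agree that in_H by (metis nle_le)
  have "F holomorphic_on H K" for K
    using holomorphic_cong[of "H K" "H K" F "Z K"] F Z(1) by auto
  then have "F holomorphic_on (\<Union>K. H K)"
    by (intro holomorphic_on_UN_open H)
  moreover have "(\<Union>K. H K) = UNIV" using in_H by blast
  ultimately have "F holomorphic_on UNIV" by simp
  moreover have "F s = (s - 1) * (\<Sum>n. 1 / of_nat (Suc n) powr s)" if "Re s > 1" for s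
    unfolding F_def by (rule Z(2)[OF that])
  ultimately show thesis by (rule that)
qed

text \<open>Justifies the definite description behind \<open>zeta\<close>. Existence comes from
  dividing the entire function by s - 1, uniqueness from the identity theorem on the connected
  punctured plane together with the fixed value at 1.\<close>

lemma zeta_characterization:
  "zeta holomorphic_on (- {1}) \<and>
    (\<forall>s. Re s > 1 \<longrightarrow> (\<lambda>n. 1 / of_nat (Suc n) powr s) sums zeta s) \<and> zeta 1 = 0"
proof -
  obtain F :: "complex \<Rightarrow> complex" where F: "F holomorphic_on UNIV"
    "\<And>s. Re s > 1 \<Longrightarrow> F s = (s - 1) * (\<Sum>n. 1 / of_nat (Suc n) powr s)"
    using dirichlet_continuation by blast
  let ?P = "\<lambda>f. f holomorphic_on (- {1}) \<and>
    (\<forall>s. Re s > 1 \<longrightarrow> (\<lambda>n. 1 / of_nat (Suc n) powr s) sums f s) \<and> f 1 = (0::complex)"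
  define g where "g = (\<lambda>s. if s = 1 then 0 else F s / (s - 1))"
  have "(\<lambda>s. F s / (s - 1)) holomorphic_on (- {1})"
    using F(1) by (intro holomorphic_intros) (auto intro: holomorphic_on_subset)
  then have "g holomorphic_on (- {1})"
    by (rule holomorphic_transform) (auto simp: g_def)
  moreover have "(\<lambda>n. 1 / of_nat (Suc n) powr s) sums g s" if "Re s > 1" for s
  proof -
    have "s \<noteq> 1" using that by auto
    then show ?thesis
      using summable_sums[OF summable_dirichlet[OF that]] F(2)[OF that] by (simp add: g_def)
  qed
  ultimately have g: "?P g" by (simp add: g_def)
  have "\<exists>!f. ?P f"
  proof (rule ex1I[of _ g])
    fix f assume f: "?P f"
    show "f = g"
    proof
      fix s
      show "f s = g s"
      proof (cases "s = 1")
        case False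
        show ?thesis
        proof (rule analytic_continuation_open[where f = f and g = g and s = "{s. Re s > 1}" and s' = "- {1}"])
          show "{s. Re s > 1} \<noteq> {}" by (auto intro!: exI[of _ 2])
          show "connected (- {1::complex})" by (rule connected_punctured_universe) simp
          show "f z = g z" if "z \<in> {s. Re s > 1}" for z
            using f g that sums_unique2 by blast
        qed (use f g False in \<open>auto simp: open_halfspace_Re_gt\<close>)
      qed (use f g in auto)
    qed
  qed (rule g)
  then have "?P (THE f. ?P f)" by (rule theI')
  then show ?thesis unfolding zeta_def .
qed

section \<open>A limit formula for zeta on Re s > -1\<close>

text \<open>The right side is (s - 1) times the trapezoidal error of x^(-s) on [m, m + 1]. The
  weights are chosen so that the terms in m^(-s-1) cancel. Both remainders have series that are
  holomorphic for Re s > -1.\<close>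

lemma euler_maclaurin_term:
  fixes s :: complex
  assumes "m \<ge> 1"
  shows "(s - 1) / 2 * binom_rem 1 (- s) m + binom_rem 2 (1 - s) m =
    (s - 1) * (of_nat m powr (- s) + of_nat (Suc m) powr (- s)) / 2
      + of_nat (Suc m) powr (1 - s) - of_nat m powr (1 - s)"
proof -
  have g2: "((1 - s) gchoose 2) = (1 - s) * (- s) / 2"
    by (simp add: gbinomial_prod_rev numeral_2_eq_2)
  have "of_nat m powr (1 - s - of_nat 1) = (of_nat m powr (- s) :: complex)" by simp
  moreover have "1 - s - of_nat 2 = - s - of_nat 1" by simp
  then have "of_nat m powr (1 - s - of_nat 2) = (of_nat m powr (- s - of_nat 1) :: complex)" by (simp only:)
  moreover define x :: complex where "x = of_nat m powr (- s - of_nat 1)"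
  moreover have "{..1} = {0, 1::nat}" "{..2} = {0, 1, 2::nat}" by auto
  ultimately show ?thesis
    unfolding binom_rem_def x_def[symmetric]
    by (simp add: g2 x_def[symmetric] del: of_nat_Suc of_nat_1 of_nat_numeral One_nat_def) (simp add: field_simps del: of_nat_Suc)
qed

text \<open>Multiplied by s - 1, the sequence has the increments of
  \<open>euler_maclaurin_term\<close>, so its limit is holomorphic on Re s > -1. For Re s > 1 the
  correction terms tend to 0 and the limit is (s - 1) \<zeta>(s); the identity theorem extends
  this.\<close>

lemma zeta_partial_sums_tendsto_complex:
  assumes s: "Re s > -1" "s \<noteq> 1"
  shows "(\<lambda>N. (\<Sum>k<Suc N. of_nat (Suc k) powr (- s)) - of_nat (Suc N) powr (- s) / 2
            - of_nat (Suc N) powr (1 - s) / (1 - s)) \<longlonglongrightarrow> zeta s"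
proof -
  define u where "u = (\<lambda>N s. (s - 1) * ((\<Sum>k<Suc N. of_nat (Suc k) powr (- s)) - of_nat (Suc N) powr (- s) / 2)
      + of_nat (Suc N) powr (1 - s) :: complex)"
  define t where "t = (\<lambda>n s. (s - 1) / 2 * binom_rem 1 (- s) (Suc n) + binom_rem 2 (1 - s) (Suc n))"
  define G where "G = (\<lambda>s. (s + 1) / 2 + ((s - 1) / 2 * (\<Sum>n. binom_rem 1 (- s) (Suc n))
      + (\<Sum>n. binom_rem 2 (1 - s) (Suc n))))"
  have u0: "u 0 s = (s + 1) / 2" for s by (simp add: u_def field_simps)
  have u_Suc: "u (Suc N) s = u N s + t N s" for N s
    unfolding t_def by (subst euler_maclaurin_term) (auto simp: u_def field_simps)
  have u_sum: "u N s = (s + 1) / 2 + (\<Sum>n<N. t n s)" for N s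
    by (induction N) (auto simp: u0 u_Suc)
  have u_lim: "(\<lambda>N. u N s) \<longlonglongrightarrow> G s" if "Re s > -1" for s
  proof -
    have "(\<lambda>n. t n s) sums ((s - 1) / 2 * (\<Sum>n. binom_rem 1 (- s) (Suc n)) + (\<Sum>n. binom_rem 2 (1 - s) (Suc n)))"
      unfolding t_def using that by (intro sums_add sums_mult summable_sums summable_binom_rem) auto
    then show ?thesis unfolding u_sum G_def sums_def by (intro tendsto_intros)
  qed
  have G_zeta: "G s = (s - 1) * zeta s" if "Re s > 1" for s
  proof -
    have "(\<lambda>N. \<Sum>k<N. 1 / of_nat (Suc k) powr s) \<longlonglongrightarrow> zeta s"
      using zeta_characterization that unfolding sums_def by blast
    then have "(\<lambda>N. \<Sum>k<N. of_nat (Suc k) powr (- s)) \<longlonglongrightarrow> zeta s"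
      by (simp add: powr_minus_divide)
    then have "(\<lambda>N. \<Sum>k<Suc N. of_nat (Suc k) powr (- s)) \<longlonglongrightarrow> zeta s"
      by (rule filterlim_compose[OF _ filterlim_Suc])
    then have "(\<lambda>N. u N s) \<longlonglongrightarrow> (s - 1) * (zeta s - 0 / 2) + 0"
      unfolding u_def using that by (intro tendsto_intros of_nat_powr_tendsto_0) auto
    then show ?thesis using u_lim[of s] that LIMSEQ_unique by fastforce
  qed
  have "G s = (s - 1) * zeta s"
  proof (rule analytic_continuation_open[where f = G and g = "\<lambda>s. (s - 1) * zeta s"
        and s = "{s. Re s > 1}" and s' = "{s. Re s > -1} - {1}"])
    show "{s. Re s > 1} \<noteq> {}" by (auto intro!: exI[of _ 2])
    show "open ({s. Re s > -1} - {1})" by (intro open_Diff open_halfspace_Re_gt) auto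
    show "connected ({s. Re s > -1} - {1})"
      by (intro connected_open_delete convex_connected convex_halfspace_Re_gt open_halfspace_Re_gt) auto
    have 1: "((\<lambda>a. \<Sum>n. binom_rem 1 a (Suc n)) \<circ> uminus) holomorphic_on ({s. Re s > -1} - {1})"
      by (intro holomorphic_on_compose_gen[OF _ holomorphic_suminf_binom_rem] holomorphic_intros) auto
    have 2: "((\<lambda>a. \<Sum>n. binom_rem 2 a (Suc n)) \<circ> (\<lambda>s. 1 - s)) holomorphic_on ({s. Re s > -1} - {1})"
      by (intro holomorphic_on_compose_gen[OF _ holomorphic_suminf_binom_rem] holomorphic_intros) auto
    show "G holomorphic_on ({s. Re s > -1} - {1})"
      unfolding G_def using 1 2 by (intro holomorphic_intros) (auto simp: o_def)
    have "zeta holomorphic_on ({s. Re s > -1} - {1})"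
      using zeta_characterization by (auto intro: holomorphic_on_subset)
    then show "(\<lambda>s. (s - 1) * zeta s) holomorphic_on ({s. Re s > -1} - {1})"
      by (intro holomorphic_intros)
  qed (use s G_zeta in \<open>auto simp: open_halfspace_Re_gt\<close>)
  then have "(\<lambda>N. u N s / (s - 1)) \<longlonglongrightarrow> (s - 1) * zeta s / (s - 1)"
    using u_lim[of s] s by (intro tendsto_intros) auto
  moreover have "u N s / (s - 1) = (\<Sum>k<Suc N. of_nat (Suc k) powr (- s)) - of_nat (Suc N) powr (- s) / 2
            - of_nat (Suc N) powr (1 - s) / (1 - s)" for N
  proof -
    have "(1 - s) = - (s - 1)" by simp
    then have "X / (1 - s) = - (X / (s - 1))" for X by (simp only: divide_minus_right)
    then show ?thesis unfolding u_def using s by (simp add: add_divide_distrib del: sum.lessThan_Suc of_nat_Suc)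
  qed
  ultimately show ?thesis using s by simp
qed

section \<open>Partial sums and trapezoidal errors\<close>

text \<open>Euler-Maclaurin approximation of \<zeta>(s), whose increments are trapezoidal errors of
  x^(-s). Since \<open>0 powr c = 0\<close>, it vanishes at N = 0, so telescoping sums of increments
  have no lower boundary term.\<close>

definition zeta_partial :: "real \<Rightarrow> nat \<Rightarrow> real" where
  "zeta_partial s N = (\<Sum>k=1..N. real k powr (- s)) - real N powr (- s) / 2 - real N powr (1 - s) / (1 - s)"

lemma zeta_partial_tendsto:
  assumes "-1 < s" "s < 1"
  shows "zeta_partial s \<longlonglongrightarrow> Re (zeta (of_real s))"
proof -
  have *: "of_nat (Suc k) powr complex_of_real c = complex_of_real (real (Suc k) powr c)" for k c
    using powr_of_real[of "real (Suc k)" c] by simp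
  have "(\<lambda>N. (\<Sum>k<Suc N. of_nat (Suc k) powr (- complex_of_real s)) - of_nat (Suc N) powr (- complex_of_real s) / 2
            - of_nat (Suc N) powr (1 - complex_of_real s) / (1 - complex_of_real s)) \<longlonglongrightarrow> zeta (of_real s)"
    using assms by (intro zeta_partial_sums_tendsto_complex) auto
  moreover have "(\<Sum>k<Suc N. of_nat (Suc k) powr (- complex_of_real s)) - of_nat (Suc N) powr (- complex_of_real s) / 2
            - of_nat (Suc N) powr (1 - complex_of_real s) / (1 - complex_of_real s)
          = of_real (zeta_partial s (Suc N))" for N
  proof -
    have "(\<Sum>k=1..Suc N. real k powr (- s)) = (\<Sum>k<Suc N. real (Suc k) powr (- s))"
      by (rule sum.reindex_bij_witness[of _ Suc "\<lambda>k. k - 1"]) auto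
    then show ?thesis
      unfolding zeta_partial_def
      using *[of _ "- s"] *[of _ "1 - s"] by (simp del: of_nat_Suc sum.lessThan_Suc sum.cl_ivl_Suc)
  qed
  ultimately have "(\<lambda>N. complex_of_real (zeta_partial s (Suc N))) \<longlonglongrightarrow> zeta (of_real s)" by simp
  then have "(\<lambda>N. zeta_partial s (Suc N)) \<longlonglongrightarrow> Re (zeta (of_real s))"
    using tendsto_Re by fastforce
  then show ?thesis by (rule LIMSEQ_imp_Suc)
qed

lemma has_integral_abs_le:
  fixes f g :: "real \<Rightarrow> real"
  assumes "(f has_integral I) {a..b}" "(g has_integral J) {a..b}"
    "\<And>x. a \<le> x \<Longrightarrow> x \<le> b \<Longrightarrow> \<bar>f x\<bar> \<le> g x"
  shows "\<bar>I\<bar> \<le> J"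
  using integral_norm_bound_integral[of f "{a..b}" g] assms
  by (auto simp: has_integral_integrable integral_unique)

text \<open>The rule is exact on affine functions, so the tangent at a may be subtracted. The rest
  is 0 at a and at most D on the interval: its value at a + 1 contributes D and twice its integral 2
  D.\<close>

lemma trapezoid_error_le:
  fixes \<phi> \<phi>' :: "real \<Rightarrow> real"
  assumes der: "\<And>x. a \<le> x \<Longrightarrow> x \<le> a + 1 \<Longrightarrow> (\<phi> has_real_derivative \<phi>' x) (at x within {a..a+1})"
    and D: "\<And>x. a \<le> x \<Longrightarrow> x \<le> a + 1 \<Longrightarrow> \<bar>\<phi>' x - \<phi>' a\<bar> \<le> D"
    and I: "(\<phi> has_integral I) {a..a+1}"
  shows "\<bar>\<phi> a + \<phi> (a + 1) - 2 * I\<bar> \<le> 3 * D"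
proof -
  define \<psi> where "\<psi> = (\<lambda>x. \<phi> x - \<phi> a - \<phi>' a * (x - a))"
  have \<psi>: "\<bar>\<psi> x\<bar> \<le> D" if "a \<le> x" "x \<le> a + 1" for x
  proof -
    have "norm (\<psi> x - \<psi> a) \<le> D * norm (x - a)"
    proof (rule field_differentiable_bound[where S = "{a..a+1}" and f' = "\<lambda>x. \<phi>' x - \<phi>' a"])
      show "(\<psi> has_real_derivative \<phi>' z - \<phi>' a) (at z within {a..a+1})" if "z \<in> {a..a+1}" for z
        unfolding \<psi>_def using that by (auto intro!: derivative_eq_intros der)
    qed (use that D in auto)
    also have "\<dots> \<le> D * 1"
      using that D[of a] by (intro mult_left_mono) auto
    finally show ?thesis by (simp add: \<psi>_def)
  qed
  have "((\<lambda>x. x) has_integral (((a + 1)\<^sup>2 - a\<^sup>2) / 2)) {a..a+1}"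
    by (rule ident_has_integral) simp
  moreover have c: "((\<lambda>x. c) has_integral c) {a..a+1}" for c
    using has_integral_const_real[of c a "a + 1"] by simp
  ultimately have "(\<psi> has_integral (I - \<phi> a - \<phi>' a * ((((a + 1)\<^sup>2 - a\<^sup>2) / 2) - a))) {a..a+1}"
    unfolding \<psi>_def by (intro has_integral_diff has_integral_mult_right I c)
  then have "\<bar>I - \<phi> a - \<phi>' a * ((((a + 1)\<^sup>2 - a\<^sup>2) / 2) - a)\<bar> \<le> D"
    by (rule has_integral_abs_le[OF _ c]) (use \<psi> in auto)
  then have "\<bar>I - \<phi> a - \<phi>' a / 2\<bar> \<le> D"
    by (simp add: power2_eq_square field_simps)
  moreover have "\<phi> a + \<phi> (a + 1) - 2 * I = \<psi> (a + 1) - 2 * (I - \<phi> a - \<phi>' a / 2)"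
    by (simp add: \<psi>_def)
  moreover have "\<bar>x - 2 * y\<bar> \<le> 3 * D" if "\<bar>x\<bar> \<le> D" "\<bar>y\<bar> \<le> D" for x y
    using that by linarith
  ultimately show ?thesis using \<psi>[of "a + 1"] by simp
qed

lemma has_integral_powr:
  fixes a b c :: real
  assumes "0 < a" "a \<le> b" "c \<noteq> -1"
  shows "((\<lambda>x. x powr c) has_integral (b powr (c + 1) / (c + 1) - a powr (c + 1) / (c + 1))) {a..b}"
proof (rule fundamental_theorem_of_calculus)
  fix x assume "x \<in> {a..b}"
  then show "((\<lambda>x. x powr (c + 1) / (c + 1)) has_vector_derivative x powr c) (at x within {a..b})"
    unfolding has_real_derivative_iff_has_vector_derivative[symmetric]
    using assms by (auto intro!: derivative_eq_intros)
qed (use assms in auto)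

text \<open>Each increment is a trapezoidal error. As x^(-s-1) decreases for s > -1, the variation
  of the derivative over a cell is a difference of endpoint values, and these telescope from N to
  infinity.\<close>

lemma zeta_partial_rate:
  assumes s: "-1 < s" "s < 1" and N: "N \<ge> 1"
  shows "\<bar>zeta_partial s N - Re (zeta (of_real s))\<bar> \<le> 3 / 2 * \<bar>s\<bar> * real N powr (- s - 1)"
proof -
  have step: "\<bar>zeta_partial s (Suc k) - zeta_partial s k\<bar> \<le>
     3 / 2 * \<bar>s\<bar> * (real k powr (- s - 1) - real (Suc k) powr (- s - 1))" if k: "k \<ge> 1" for k
  proof -
    let ?I = "real (Suc k) powr (1 - s) / (1 - s) - real k powr (1 - s) / (1 - s)"
    have "\<bar>real k powr (- s) + (real k + 1) powr (- s) - 2 * ?I\<bar> \<le>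
        3 * (\<bar>s\<bar> * (real k powr (- s - 1) - real (Suc k) powr (- s - 1)))"
    proof (rule trapezoid_error_le[where \<phi>' = "\<lambda>x. - s * x powr (- s - 1)"])
      show "((\<lambda>x. x powr - s) has_integral ?I) {real k..real k + 1}"
        using has_integral_powr[of "real k" "real k + 1" "- s"] s k by (simp add: add.commute)
      fix x assume x: "real k \<le> x" "x \<le> real k + 1"
      then show "((\<lambda>x. x powr - s) has_real_derivative - s * x powr (- s - 1)) (at x within {real k..real k + 1})"
        using k by (auto intro!: derivative_eq_intros)
      have "x powr (- s - 1) \<le> real k powr (- s - 1)" "real (Suc k) powr (- s - 1) \<le> x powr (- s - 1)"
        using x k s by (auto intro!: powr_mono2')
      moreover have "- s * x powr (- s - 1) - - s * real k powr (- s - 1) = s * (real k powr (- s - 1) - x powr (- s - 1))"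
        by (simp add: algebra_simps)
      ultimately show "\<bar>- s * x powr (- s - 1) - - s * real k powr (- s - 1)\<bar> \<le>
          \<bar>s\<bar> * (real k powr (- s - 1) - real (Suc k) powr (- s - 1))"
        by (simp add: abs_mult mult_left_mono del: of_nat_Suc)
    qed
    moreover have "2 * (zeta_partial s (Suc k) - zeta_partial s k) =
        real k powr (- s) + (real k + 1) powr (- s) - 2 * ?I"
      by (simp add: zeta_partial_def add.commute)
    ultimately have "\<bar>2 * (zeta_partial s (Suc k) - zeta_partial s k)\<bar> \<le>
        3 * (\<bar>s\<bar> * (real k powr (- s - 1) - real (Suc k) powr (- s - 1)))"
      by (simp only:)
    then show ?thesis unfolding abs_mult by simp
  qed
  have bound: "\<bar>zeta_partial s (N + m) - zeta_partial s N\<bar> \<le>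
     3 / 2 * \<bar>s\<bar> * (real N powr (- s - 1) - real (N + m) powr (- s - 1))" for m
  proof (induction m)
    case (Suc m)
    show ?case
      using Suc step[of "N + m"] N unfolding add_Suc_right right_diff_distrib by linarith
  qed simp
  have "(\<lambda>m. zeta_partial s (m + N)) \<longlonglongrightarrow> Re (zeta (of_real s))"
    using zeta_partial_tendsto[OF s] by (rule LIMSEQ_ignore_initial_segment)
  then have "(\<lambda>m. \<bar>zeta_partial s N - zeta_partial s (m + N)\<bar>) \<longlonglongrightarrow> \<bar>zeta_partial s N - Re (zeta (of_real s))\<bar>"
    by (intro tendsto_intros)
  moreover have "\<bar>zeta_partial s N - zeta_partial s (m + N)\<bar> \<le> 3 / 2 * \<bar>s\<bar> * real N powr (- s - 1)" for m
  proof -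
    have "3 / 2 * \<bar>s\<bar> * (real N powr (- s - 1) - real (N + m) powr (- s - 1)) \<le> 3 / 2 * \<bar>s\<bar> * real N powr (- s - 1)"
      by (intro mult_left_mono) auto
    then show ?thesis using bound[of m] by (simp add: add.commute abs_minus_commute)
  qed
  ultimately show ?thesis by (intro tendsto_upperbound) auto
qed

text \<open>The cost of freezing the weight at p0 on a unit cell: the integral of (p - p0) v is
  estimated pointwise.\<close>

lemma weighted_integral_diff_le:
  fixes p v :: "real \<Rightarrow> real"
  assumes "((\<lambda>x. p x * v x) has_integral W) {a..a+1}" "(v has_integral E) {a..a+1}"
    "\<And>x. a \<le> x \<Longrightarrow> x \<le> a + 1 \<Longrightarrow> \<bar>p x - p0\<bar> \<le> P"
    "\<And>x. a \<le> x \<Longrightarrow> x \<le> a + 1 \<Longrightarrow> \<bar>v x\<bar> \<le> A"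
  shows "\<bar>W - p0 * E\<bar> \<le> P * A"
proof (rule has_integral_abs_le)
  show "((\<lambda>x. p x * v x - p0 * v x) has_integral (W - p0 * E)) {a..a+1}"
    by (intro has_integral_diff has_integral_mult_right assms)
  show "((\<lambda>x. P * A) has_integral (P * A)) {a..a+1}"
    using has_integral_const_real[of "P * A" a "a + 1"] by simp
  fix x assume "a \<le> x" "x \<le> a + 1"
  then have "\<bar>p x - p0\<bar> * \<bar>v x\<bar> \<le> P * A"
    using assms(3,4)[of x] by (intro mult_mono) linarith+
  then show "\<bar>p x * v x - p0 * v x\<bar> \<le> P * A"
    by (simp add: left_diff_distrib[symmetric] abs_mult)
qed

lemma powr_diff_le:
  fixes x y l u c B :: real
  assumes "0 < l" "l \<le> x" "x \<le> u" "l \<le> y" "y \<le> u"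
    and B: "\<And>z. l \<le> z \<Longrightarrow> z \<le> u \<Longrightarrow> z powr (c - 1) \<le> B"
  shows "\<bar>x powr c - y powr c\<bar> \<le> \<bar>c\<bar> * B * \<bar>x - y\<bar>"
proof -
  have "norm (x powr c - y powr c) \<le> (\<bar>c\<bar> * B) * norm (x - y)"
  proof (rule field_differentiable_bound[where S = "{l..u}" and f' = "\<lambda>z. c * z powr (c - 1)"])
    fix z assume z: "z \<in> {l..u}"
    then show "((\<lambda>z. z powr c) has_real_derivative c * z powr (c - 1)) (at z within {l..u})"
      using assms(1) by (auto intro!: derivative_eq_intros)
    show "norm (c * z powr (c - 1)) \<le> \<bar>c\<bar> * B"
      using B z by (auto simp: abs_mult intro!: mult_left_mono)
  qed (use assms in auto)
  then show ?thesis by simp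
qed

text \<open>For c \<le> 1 the factor z^(c-1) of the derivative is largest at the lower end
  l.\<close>

lemma powr_diff_le_lower:
  fixes x y l c :: real
  assumes "0 < l" "l \<le> x" "l \<le> y" "c \<le> 1"
  shows "\<bar>x powr c - y powr c\<bar> \<le> \<bar>c\<bar> * l powr (c - 1) * \<bar>x - y\<bar>"
  by (rule powr_diff_le[where u = "max x y"]) (use assms in \<open>auto intro!: powr_mono2'\<close>)

lemma has_integral_Beta_scaled:
  fixes a b t :: real
  assumes "a > 0" "b > 0" "t > 0"
  shows "((\<lambda>x. x powr (a - 1) * (t - x) powr (b - 1)) has_integral t powr (a + b - 1) * Beta a b) {0..t}"
proof -
  have "((\<lambda>x. (1 / t * x) powr (a - 1) * (1 - 1 / t * x) powr (b - 1)) has_integral (1 / \<bar>1 / t\<bar>) *\<^sub>R Beta a b)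
     ((\<lambda>x. x / (1 / t)) ` {0..1})"
    using assms by (intro has_integral_stretch_real has_integral_Beta_real) auto
  also have "(\<lambda>x. x / (1 / t)) ` {0..1} = {0..t}"
    using assms by (auto simp: image_iff field_simps intro!: bexI[of _ "_ / t"])
  finally have "((\<lambda>x. t powr (a + b - 2) * ((1 / t * x) powr (a - 1) * (1 - 1 / t * x) powr (b - 1)))
     has_integral t powr (a + b - 2) * (t * Beta a b)) {0..t}"
    using assms by (intro has_integral_mult_right) simp
  then have 1: "((\<lambda>x. x powr (a - 1) * (t - x) powr (b - 1)) has_integral t powr (a + b - 2) * (t * Beta a b)) {0..t}"
  proof (rule has_integral_eq[rotated])
    fix x assume "x \<in> {0..t}"
    moreover have "1 - 1 / t * x = (t - x) / t" using assms by (simp add: field_simps)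
    moreover have "t powr (a + b - 2) = t powr (a - 1) * t powr (b - 1)"
      by (simp add: powr_add[symmetric])
    ultimately show "t powr (a + b - 2) * ((1 / t * x) powr (a - 1) * (1 - 1 / t * x) powr (b - 1)) =
        x powr (a - 1) * (t - x) powr (b - 1)"
      using assms by (simp add: powr_divide field_simps)
  qed
  have 2: "t powr (a + b - 2) * (t * Beta a b) = t powr (a + b - 1) * Beta a b"
    using powr_add[of t "a + b - 2" 1] assms by simp
  show ?thesis using 1 unfolding 2 .
qed

lemma sum_integral_unit_cells:
  fixes f :: "real \<Rightarrow> real"
  assumes "f integrable_on {0..real n}"
  shows "(\<Sum>k<n. integral {real k..real k + 1} f) = integral {0..real n} f"
proof -
  have "m \<le> n \<Longrightarrow> (\<Sum>k<m. integral {real k..real k + 1} f) = integral {0..real m} f" for m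
  proof (induction m)
    case (Suc m)
    have "integral {0..real m} f + integral {real m..real m + 1} f = integral {0..real m + 1} f"
      using Suc.prems by (intro Henstock_Kurzweil_Integration.integral_combine integrable_on_subinterval[OF assms]) auto
    then show ?case using Suc by (simp add: add.commute)
  qed simp
  then show ?thesis by simp
qed

section \<open>Unit cells and the trapezoidal defect of the kernel\<close>

locale power_quadrature =
  fixes \<alpha> \<beta> :: real
  assumes \<alpha>: "0 < \<alpha>" "\<alpha> < 1" and \<beta>: "0 < \<beta>"
begin

definition p :: "real \<Rightarrow> real" where "p x = \<beta> * x powr (\<beta> - 1)"

text \<open>Since \<open>0 powr c = 0\<close>, \<open>q n n = 0\<close>; this accounts for the term \<open>y\<^sub>n\<^sub>-\<^sub>1 / 2\<^sup>\<alpha>\<close>, which has no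
  counterpart of \<open>(k - 1)\<^sup>-\<^sup>\<alpha>\<close>.\<close>

definition q :: "nat \<Rightarrow> real \<Rightarrow> real" where "q n x = (real n - x) powr (- \<alpha>)"

definition v :: "nat \<Rightarrow> nat \<Rightarrow> real \<Rightarrow> real" where
  "v n k x = q n (real k) + q n (real k + 1) - 2 * q n x"

text \<open>The mean of the defect \<open>v n k\<close> over its cell, with the integral of
  \<open>q\<close> in closed form.\<close>

definition \<epsilon> :: "nat \<Rightarrow> nat \<Rightarrow> real" where
  "\<epsilon> n k = q n (real k) + q n (real k + 1) -
     2 * (((real n - real k) powr (1 - \<alpha>) - (real n - real k - 1) powr (1 - \<alpha>)) / (1 - \<alpha>))"

text \<open>The contribution of one unit cell to the quadrature sum minus twice the Beta
  integral.\<close>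

definition cell :: "nat \<Rightarrow> nat \<Rightarrow> real" where
  "cell n k = integral {real k..real k + 1} (\<lambda>x. p x * v n k x)"

text \<open>In the last cell the kernel is unbounded near x = n, so the fundamental theorem is used
  with derivatives in the interior only and a primitive continuous up to the end.\<close>

lemma has_integral_q:
  assumes "k < n"
  shows "(q n has_integral ((real n - real k) powr (1 - \<alpha>) - (real n - real k - 1) powr (1 - \<alpha>)) / (1 - \<alpha>))
    {real k..real k + 1}"
proof -
  define F where "F = (\<lambda>x. - ((real n - x) powr (1 - \<alpha>)) / (1 - \<alpha>))"
  have "(q n has_integral (F (real k + 1) - F (real k))) {real k..real k + 1}"
  proof (rule fundamental_theorem_of_calculus_interior)
    show "continuous_on {real k..real k + 1} F"
      unfolding F_def using \<alpha> assms by (intro continuous_intros continuous_on_powr') auto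
    fix x assume "x \<in> {real k<..<real k + 1}"
    then have "(F has_real_derivative - ((1 - \<alpha>) * (real n - x) powr (1 - \<alpha> - 1) * (- 1)) / (1 - \<alpha>)) (at x)"
      unfolding F_def using assms \<alpha> by (auto intro!: derivative_eq_intros)
    then show "(F has_vector_derivative q n x) (at x)"
      unfolding has_real_derivative_iff_has_vector_derivative[symmetric] q_def using \<alpha> by simp
  qed simp
  then show ?thesis by (simp add: F_def diff_diff_eq diff_divide_distrib)
qed

lemma has_integral_v:
  assumes "k < n"
  shows "(v n k has_integral \<epsilon> n k) {real k..real k + 1}"
proof -
  have "((\<lambda>x. q n (real k) + q n (real k + 1)) has_integral q n (real k) + q n (real k + 1)) {real k..real k + 1}"
    using has_integral_const_real[of "q n (real k) + q n (real k + 1)" "real k" "real k + 1"] by simp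
  then show ?thesis
    unfolding v_def[abs_def] \<epsilon>_def using has_integral_q[OF assms]
    by (intro has_integral_diff has_integral_mult_right)
qed

text \<open>For \<beta> < 1 the weight is unbounded near 0; interior derivatives of the continuous
  primitive x^\<beta> suffice.\<close>

lemma has_integral_p:
  "(p has_integral ((real k + 1) powr \<beta> - real k powr \<beta>)) {real k..real k + 1}"
proof (rule fundamental_theorem_of_calculus_interior)
  show "continuous_on {real k..real k + 1} (\<lambda>x. x powr \<beta>)"
    using \<beta> by (intro continuous_intros continuous_on_powr') auto
  fix x assume "x \<in> {real k<..<real k + 1}"
  then show "((\<lambda>x. x powr \<beta>) has_vector_derivative p x) (at x)"
    unfolding has_real_derivative_iff_has_vector_derivative[symmetric] p_def
    by (auto intro!: derivative_eq_intros)
qed simp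

lemma has_integral_p_mult_id:
  "((\<lambda>x. p x * x) has_integral \<beta> * (((real k + 1) powr (\<beta> + 1) - real k powr (\<beta> + 1)) / (\<beta> + 1))) {real k..real k + 1}"
proof -
  define F where "F = (\<lambda>x. \<beta> * (x powr (\<beta> + 1) / (\<beta> + 1)))"
  have "((\<lambda>x. p x * x) has_integral (F (real k + 1) - F (real k))) {real k..real k + 1}"
  proof (rule fundamental_theorem_of_calculus_interior)
    show "continuous_on {real k..real k + 1} F"
      unfolding F_def using \<beta> by (intro continuous_intros continuous_on_powr') auto
    fix x assume x: "x \<in> {real k<..<real k + 1}"
    then have "x > 0" by simp
    then have "x powr (\<beta> - 1) * x = x powr \<beta>" using powr_add[of x "\<beta> - 1" 1] by simp
    then show "(F has_vector_derivative p x * x) (at x)"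
      unfolding has_real_derivative_iff_has_vector_derivative[symmetric] p_def F_def
      using x \<beta> by (auto intro!: derivative_eq_intros)
  qed simp
  then show ?thesis by (simp add: F_def diff_divide_distrib right_diff_distrib)
qed

lemma has_integral_p_mult_q:
  assumes "n > 0"
  shows "((\<lambda>x. p x * q n x) has_integral \<beta> * Beta \<beta> (1 - \<alpha>) * real n powr (\<beta> - \<alpha>)) {0..real n}"
  using has_integral_mult_right[OF has_integral_Beta_scaled[of \<beta> "1 - \<alpha>" "real n"], of \<beta>] \<alpha> \<beta> assms
  by (simp add: p_def q_def algebra_simps)

lemma integrable_p_mult_q:
  assumes "k < n"
  shows "(\<lambda>x. p x * q n x) integrable_on {real k..real k + 1}"
  using assms by (intro integrable_on_subinterval[OF has_integral_integrable[OF has_integral_p_mult_q[of n]]]) auto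

lemma has_integral_cell:
  assumes "k < n"
  shows "((\<lambda>x. p x * v n k x) has_integral cell n k) {real k..real k + 1}"
    and "cell n k = (q n (real k) + q n (real k + 1)) * ((real k + 1) powr \<beta> - real k powr \<beta>)
       - 2 * integral {real k..real k + 1} (\<lambda>x. p x * q n x)"
proof -
  have "((\<lambda>x. (q n (real k) + q n (real k + 1)) * p x - 2 * (p x * q n x)) has_integral
      ((q n (real k) + q n (real k + 1)) * ((real k + 1) powr \<beta> - real k powr \<beta>)
       - 2 * integral {real k..real k + 1} (\<lambda>x. p x * q n x))) {real k..real k + 1}"
    by (intro has_integral_diff has_integral_mult_right has_integral_p integrable_integral integrable_p_mult_q assms)
  also have "(\<lambda>x. (q n (real k) + q n (real k + 1)) * p x - 2 * (p x * q n x)) = (\<lambda>x. p x * v n k x)"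
    by (auto simp: v_def algebra_simps)
  finally have *: "((\<lambda>x. p x * v n k x) has_integral
      ((q n (real k) + q n (real k + 1)) * ((real k + 1) powr \<beta> - real k powr \<beta>)
       - 2 * integral {real k..real k + 1} (\<lambda>x. p x * q n x))) {real k..real k + 1}" .
  then show "cell n k = (q n (real k) + q n (real k + 1)) * ((real k + 1) powr \<beta> - real k powr \<beta>)
       - 2 * integral {real k..real k + 1} (\<lambda>x. p x * q n x)"
    unfolding cell_def by (rule integral_unique)
  with * show "((\<lambda>x. p x * v n k x) has_integral cell n k) {real k..real k + 1}" by simp
qed

text \<open>Reduces the comparison of the quadrature sum with the Beta integral to estimates of
  single cells.\<close>

lemma sum_cell:
  assumes "n > 0"
  shows "(\<Sum>k<n. cell n k) =
     (\<Sum>k<n. (q n (real k) + q n (real k + 1)) * ((real k + 1) powr \<beta> - real k powr \<beta>))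
     - 2 * (\<beta> * Beta \<beta> (1 - \<alpha>) * real n powr (\<beta> - \<alpha>))"
proof -
  have "(\<Sum>k<n. cell n k) =
     (\<Sum>k<n. (q n (real k) + q n (real k + 1)) * ((real k + 1) powr \<beta> - real k powr \<beta>))
     - 2 * (\<Sum>k<n. integral {real k..real k + 1} (\<lambda>x. p x * q n x))"
    by (simp add: has_integral_cell(2) sum_subtractf sum_distrib_left)
  also have "(\<Sum>k<n. integral {real k..real k + 1} (\<lambda>x. p x * q n x)) =
      integral {0..real n} (\<lambda>x. p x * q n x)"
    using has_integral_p_mult_q[OF assms] by (intro sum_integral_unit_cells has_integral_integrable)
  also have "\<dots> = \<beta> * Beta \<beta> (1 - \<alpha>) * real n powr (\<beta> - \<alpha>)"
    using has_integral_p_mult_q[OF assms] by (rule integral_unique)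
  finally show ?thesis .
qed

text \<open>Measured from the right end, the cell is [n - k - 1, n - k] and the mean defect is twice
  the trapezoidal error of x^(-\<alpha>) there. The last cell fits in because of
  \<open>0 powr c = 0\<close>.\<close>

lemma \<epsilon>_eq_zeta_partial_diff:
  assumes "k < n"
  shows "\<epsilon> n k = 2 * (zeta_partial \<alpha> (n - k) - zeta_partial \<alpha> (n - Suc k))"
proof -
  obtain m where n: "n = Suc (k + m)" using assms less_iff_Suc_add by blast
  then have *: "n - k = Suc m" "n - Suc k = m" "real n - real k = real (Suc m)" "real n - (real k + 1) = real m"
    "real n - real k - 1 = real m" by auto
  show ?thesis
    unfolding \<epsilon>_def q_def * by (simp add: zeta_partial_def diff_divide_distrib)
qed

lemma sum_\<epsilon>:
  assumes "M \<le> n"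
  shows "(\<Sum>k=M..<n. \<epsilon> n k) = 2 * zeta_partial \<alpha> (n - M)"
proof -
  have "(\<Sum>k=M..<n. \<epsilon> n k) = (\<Sum>k=M..<n. (- 2 * zeta_partial \<alpha> (n - Suc k)) - (- 2 * zeta_partial \<alpha> (n - k)))"
    by (intro sum.cong refl) (simp add: \<epsilon>_eq_zeta_partial_diff)
  also have "\<dots> = (- 2 * zeta_partial \<alpha> (n - n)) - (- 2 * zeta_partial \<alpha> (n - M))"
    using assms by (rule sum_Suc_diff')
  finally show ?thesis by (simp add: zeta_partial_def)
qed

lemma q_has_derivative:
  assumes "x < real n"
  shows "(q n has_real_derivative \<alpha> * (real n - x) powr (- \<alpha> - 1)) (at x within S)"
  unfolding q_def[abs_def] using assms by (auto intro!: derivative_eq_intros)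

text \<open>Here d is a lower bound for the distance of the cell from the singularity at n. The
  defect is a sum of two differences of q, each at most the bound d^(-\<alpha>-1) on the
  slope.\<close>

lemma v_abs_le:
  assumes "0 < d" "d \<le> real n - (real k + 1)" "real k \<le> x" "x \<le> real k + 1"
  shows "\<bar>v n k x\<bar> \<le> 2 * d powr (- \<alpha> - 1)"
proof -
  have *: "\<bar>q n y - q n x\<bar> \<le> d powr (- \<alpha> - 1)" if "real k \<le> y" "y \<le> real k + 1" for y
  proof -
    have "\<bar>q n y - q n x\<bar> \<le> \<bar>- \<alpha>\<bar> * d powr (- \<alpha> - 1) * \<bar>(real n - y) - (real n - x)\<bar>"
      unfolding q_def using assms that \<alpha> by (intro powr_diff_le_lower) auto
    also have "\<dots> \<le> 1 * d powr (- \<alpha> - 1) * 1"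
      using assms that \<alpha> by (intro mult_mono) auto
    finally show ?thesis by simp
  qed
  show ?thesis using *[of "real k"] *[of "real k + 1"] by (simp add: v_def)
qed

lemma q'_diff_le:
  assumes "0 < d" "d \<le> real n - x" "d \<le> real n - y"
  shows "\<bar>\<alpha> * (real n - x) powr (- \<alpha> - 1) - \<alpha> * (real n - y) powr (- \<alpha> - 1)\<bar> \<le> 2 * d powr (- \<alpha> - 2) * \<bar>x - y\<bar>"
proof -
  have "\<bar>(real n - x) powr (- \<alpha> - 1) - (real n - y) powr (- \<alpha> - 1)\<bar> \<le>
      \<bar>- \<alpha> - 1\<bar> * d powr (- \<alpha> - 1 - 1) * \<bar>(real n - x) - (real n - y)\<bar>"
    using assms \<alpha> by (intro powr_diff_le_lower) auto
  also have "\<dots> \<le> 2 * d powr (- \<alpha> - 2) * \<bar>x - y\<bar>"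
    using \<alpha> by (intro mult_mono) (auto simp: diff_diff_eq)
  finally have "\<alpha> * \<bar>(real n - x) powr (- \<alpha> - 1) - (real n - y) powr (- \<alpha> - 1)\<bar> \<le> 1 * (2 * d powr (- \<alpha> - 2) * \<bar>x - y\<bar>)"
    using \<alpha> by (intro mult_mono) auto
  then show ?thesis using \<alpha> by (simp add: right_diff_distrib[symmetric] abs_mult)
qed

text \<open>Averaging over the cell gains one power of d over the pointwise bound
  \<open>v_abs_le\<close>, since the trapezoidal rule is exact on affine functions.\<close>

lemma \<epsilon>_abs_le:
  assumes "0 < d" "d \<le> real n - (real k + 1)"
  shows "\<bar>\<epsilon> n k\<bar> \<le> 6 * d powr (- \<alpha> - 2)"
proof -
  have "k < n" using assms by linarith
  have "\<bar>\<epsilon> n k\<bar> \<le> 3 * (2 * d powr (- \<alpha> - 2))"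
    unfolding \<epsilon>_def
  proof (rule trapezoid_error_le[where \<phi>' = "\<lambda>x. \<alpha> * (real n - x) powr (- \<alpha> - 1)"])
    fix x assume x: "real k \<le> x" "x \<le> real k + 1"
    show "(q n has_real_derivative \<alpha> * (real n - x) powr (- \<alpha> - 1)) (at x within {real k..real k + 1})"
      using x assms by (intro q_has_derivative) auto
    have "\<bar>\<alpha> * (real n - x) powr (- \<alpha> - 1) - \<alpha> * (real n - real k) powr (- \<alpha> - 1)\<bar>
        \<le> 2 * d powr (- \<alpha> - 2) * \<bar>x - real k\<bar>"
      using x assms by (intro q'_diff_le) auto
    also have "\<dots> \<le> 2 * d powr (- \<alpha> - 2) * 1" using x by (intro mult_left_mono) auto
    finally show "\<bar>\<alpha> * (real n - x) powr (- \<alpha> - 1) - \<alpha> * (real n - real k) powr (- \<alpha> - 1)\<bar> \<le> 2 * d powr (- \<alpha> - 2)"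
      by simp
  qed (rule has_integral_q[OF \<open>k < n\<close>])
  then show ?thesis by simp
qed

end

section \<open>Summing the cells\<close>

text \<open>Cutting at \<open>n div 2\<close> keeps the right half at points comparable to n, and
  the left half at distance at least n/2 from the singularity.\<close>

lemma div2_bounds:
  assumes "n \<ge> (2::nat)"
  shows "real n / 3 \<le> real (n div 2)" "real (n div 2) \<le> real n / 2"
proof -
  have "n \<le> 3 * (n div 2)" "2 * (n div 2) \<le> n" using assms by linarith+
  then have "real n \<le> real (3 * (n div 2))" "real (2 * (n div 2)) \<le> real n"
    by (simp_all only: of_nat_le_iff)
  then show "real n / 3 \<le> real (n div 2)" "real (n div 2) \<le> real n / 2" by simp_all
qed

text \<open>After scaling by n the base lies in [1/3, 1]; the worst exponent is then -2, and 3^2 =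
  9.\<close>

lemma powr_le_of_third:
  fixes n z c :: real
  assumes "0 < n" "n / 3 \<le> z" "z \<le> n" "c \<ge> - 2"
  shows "z powr c \<le> 9 * n powr c"
proof -
  define w where "w = z / n"
  have w: "1 / 3 \<le> w" "w \<le> 1" "z = n * w" using assms by (auto simp: w_def field_simps)
  have "w powr c \<le> w powr (- 2)" using w assms by (intro powr_mono') auto
  also have "\<dots> \<le> (1 / 3) powr (- 2)" using w by (intro powr_mono2') auto
  also have "\<dots> = 9" by (simp add: powr_minus powr_divide)
  finally have "w powr c \<le> 9" .
  then show ?thesis using w assms by (simp add: powr_mult)
qed

lemma half_powr_le:
  fixes n \<alpha> m :: real
  assumes "n > 0" "\<alpha> < 1"
  shows "(n / 2) powr (- \<alpha> - m) \<le> 2 powr (1 + m) * n powr (- \<alpha> - m)"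
proof -
  have "(n / 2) powr (- \<alpha> - m) = 2 powr (\<alpha> + m) * n powr (- \<alpha> - m)"
    using assms by (simp add: powr_divide powr_minus_divide[of 2 "\<alpha> + m"] field_simps powr_diff powr_add powr_minus)
  also have "\<dots> \<le> 2 powr (1 + m) * n powr (- \<alpha> - m)"
    using assms by (intro mult_right_mono powr_mono) auto
  finally show ?thesis .
qed

lemma mult_powr_diff_2:
  fixes x c :: real
  assumes "0 \<le> x"
  shows "x * x powr (c - 2) = x powr (c - 1)"
proof -
  have "1 + (c - 2) = c - 1" by simp
  then show ?thesis using powr_mult_base[OF assms, of "c - 2"] by (simp only:)
qed

section \<open>The right half, which contains the singularity of the kernel\<close>

context power_quadrature
begin

lemma p_diff_le:
  assumes "n > 0" "real n / 3 \<le> x" "x \<le> real n" "real n / 3 \<le> y" "y \<le> real n"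
  shows "\<bar>p x - p y\<bar> \<le> 9 * \<beta> * \<bar>\<beta> - 1\<bar> * real n powr (\<beta> - 2) * \<bar>x - y\<bar>"
proof -
  have "\<bar>x powr (\<beta> - 1) - y powr (\<beta> - 1)\<bar> \<le> \<bar>\<beta> - 1\<bar> * (9 * real n powr (\<beta> - 2)) * \<bar>x - y\<bar>"
  proof (rule powr_diff_le[where l = "real n / 3" and u = "real n"])
    fix z assume "real n / 3 \<le> z" "z \<le> real n"
    then show "z powr (\<beta> - 1 - 1) \<le> 9 * real n powr (\<beta> - 2)"
      using powr_le_of_third[of "real n" z "\<beta> - 2"] assms \<beta> by simp
  qed (use assms in auto)
  then have "\<beta> * \<bar>x powr (\<beta> - 1) - y powr (\<beta> - 1)\<bar> \<le> \<beta> * (\<bar>\<beta> - 1\<bar> * (9 * real n powr (\<beta> - 2)) * \<bar>x - y\<bar>)"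
    using \<beta> by (intro mult_left_mono) auto
  then show ?thesis
    using \<beta> by (simp add: p_def right_diff_distrib[symmetric] abs_mult mult_ac)
qed

lemma cell_right_le:
  assumes "n > 0" "k + 2 \<le> n" "real n / 3 \<le> real k"
  shows "\<bar>cell n k - p (real n) * \<epsilon> n k\<bar> \<le>
    126 * \<beta> * \<bar>\<beta> - 1\<bar> * real n powr (\<beta> - 2) * real (n - k - 1) powr (- \<alpha> - 1)"
proof -
  define L where "L = 9 * \<beta> * \<bar>\<beta> - 1\<bar> * real n powr (\<beta> - 2)"
  define d where "d = real (n - k - 1)"
  have L: "L \<ge> 0" using \<beta> by (simp add: L_def)
  have d: "d = real n - (real k + 1)" "d \<ge> 1" using assms by (auto simp: d_def of_nat_diff)
  have "k < n" using assms by simp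
  have "\<bar>cell n k - p (real k) * \<epsilon> n k\<bar> \<le> L * (2 * d powr (- \<alpha> - 1))"
  proof (rule weighted_integral_diff_le[OF has_integral_cell(1) has_integral_v])
    fix x assume x: "real k \<le> x" "x \<le> real k + 1"
    have "\<bar>p x - p (real k)\<bar> \<le> L * \<bar>x - real k\<bar>"
      unfolding L_def using x assms by (intro p_diff_le) auto
    also have "\<dots> \<le> L * 1" using x L by (intro mult_left_mono) auto
    finally show "\<bar>p x - p (real k)\<bar> \<le> L" by simp
    show "\<bar>v n k x\<bar> \<le> 2 * d powr (- \<alpha> - 1)" using x d by (intro v_abs_le) auto
  qed (use \<open>k < n\<close> in auto)
  moreover have "\<bar>(p (real k) - p (real n)) * \<epsilon> n k\<bar> \<le> L * (12 * d powr (- \<alpha> - 1))"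
  proof -
    have "\<bar>p (real k) - p (real n)\<bar> \<le> L * \<bar>real k - real n\<bar>"
      unfolding L_def using assms by (intro p_diff_le) auto
    \<comment> \<open>The distance from k to n is d + 1, and d \<ge> 1.\<close>
    also have "\<dots> \<le> L * (2 * d)" using d L by (intro mult_left_mono) auto
    finally have "\<bar>p (real k) - p (real n)\<bar> \<le> L * (2 * d)" .
    moreover have "\<bar>\<epsilon> n k\<bar> \<le> 6 * d powr (- \<alpha> - 2)" using d by (intro \<epsilon>_abs_le) auto
    ultimately have "\<bar>p (real k) - p (real n)\<bar> * \<bar>\<epsilon> n k\<bar> \<le> L * (2 * d) * (6 * d powr (- \<alpha> - 2))"
      using L d by (intro mult_mono) auto
    moreover have "d * d powr (- \<alpha> - 2) = d powr (- \<alpha> - 1)"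
      using d(2) by (intro mult_powr_diff_2) simp
    then have "L * (2 * d) * (6 * d powr (- \<alpha> - 2)) = L * (12 * d powr (- \<alpha> - 1))"
      by simp
    ultimately show ?thesis by (simp add: abs_mult)
  qed
  moreover have "cell n k - p (real n) * \<epsilon> n k = (cell n k - p (real k) * \<epsilon> n k) + (p (real k) - p (real n)) * \<epsilon> n k"
    by (simp add: algebra_simps)
  ultimately have "\<bar>cell n k - p (real n) * \<epsilon> n k\<bar> \<le> L * (2 * d powr (- \<alpha> - 1)) + L * (12 * d powr (- \<alpha> - 1))"
    by linarith
  then show ?thesis by (simp add: L_def d_def)
qed

text \<open>The defect is unbounded here, so a pointwise bound is replaced by the integrable
  majorant 1 + 2 q, where q has integral 1/(1 - \<alpha>) over the cell.\<close>

lemma cell_last_le: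
  assumes "n \<ge> 2"
  shows "\<bar>cell n (n - 1) - p (real n) * \<epsilon> n (n - 1)\<bar> \<le>
    9 * \<beta> * \<bar>\<beta> - 1\<bar> * (1 + 2 / (1 - \<alpha>)) * real n powr (\<beta> - 2)"
proof -
  define L where "L = 9 * \<beta> * \<bar>\<beta> - 1\<bar> * real n powr (\<beta> - 2)"
  define k where "k = n - 1"
  have k: "k < n" "real n = real k + 1" using assms by (auto simp: k_def of_nat_diff)
  have L: "L \<ge> 0" using \<beta> by (simp add: L_def)
  have "((\<lambda>x. 1::real) has_integral 1) {real k..real k + 1}"
    using has_integral_const_real[of "1::real" "real k" "real k + 1"] by simp
  then have J: "((\<lambda>x. L * (1 + 2 * q n x)) has_integral L * (1 + 2 * (1 / (1 - \<alpha>)))) {real k..real k + 1}"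
    using has_integral_q[OF k(1)] k(2) by (intro has_integral_mult_right has_integral_add) auto
  have "\<bar>cell n k - p (real n) * \<epsilon> n k\<bar> \<le> L * (1 + 2 * (1 / (1 - \<alpha>)))"
  proof (rule has_integral_abs_le[OF _ J])
    show "((\<lambda>x. p x * v n k x - p (real n) * v n k x) has_integral (cell n k - p (real n) * \<epsilon> n k)) {real k..real k + 1}"
      by (intro has_integral_diff has_integral_mult_right has_integral_cell has_integral_v k)
    fix x assume x: "real k \<le> x" "x \<le> real k + 1"
    have q0: "q n x \<ge> 0" by (simp add: q_def)
    \<comment> \<open>At the ends of the last cell q is 1 and, by the convention for
      \<open>0 powr\<close>, 0.\<close>
    have "v n k x = 1 - 2 * q n x" unfolding v_def using k(2) by (simp add: q_def)
    then have v: "\<bar>v n k x\<bar> \<le> 1 + 2 * q n x" using q0 by simp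
    have "\<bar>p x - p (real n)\<bar> \<le> L * \<bar>x - real n\<bar>"
      unfolding L_def using x k assms by (intro p_diff_le) auto
    also have "\<dots> \<le> L * 1" using x L k by (intro mult_left_mono) auto
    finally have "\<bar>p x - p (real n)\<bar> * \<bar>v n k x\<bar> \<le> L * (1 + 2 * q n x)"
      using v L by (intro mult_mono) auto
    then show "\<bar>p x * v n k x - p (real n) * v n k x\<bar> \<le> L * (1 + 2 * q n x)"
      by (simp add: left_diff_distrib[symmetric] abs_mult)
  qed
  then show ?thesis by (simp add: L_def k_def algebra_simps)
qed

text \<open>With p frozen at n the mean defects sum to twice a zeta partial sum. The freezing errors
  are n^(\<beta>-2) times a convergent series, plus the last cell.\<close>

lemma right_half:
  "\<exists>C. \<forall>n\<ge>2. \<bar>(\<Sum>k=n div 2..<n. cell n k) - 2 * \<beta> * Re (zeta (of_real \<alpha>)) * real n powr (\<beta> - 1)\<bar> \<le> C * real n powr (\<beta> - 2)"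
proof -
  define S where "S = (\<Sum>i. real (Suc i) powr (- \<alpha> - 1))"
  define c1 where "c1 = 126 * \<beta> * \<bar>\<beta> - 1\<bar>"
  define c2 where "c2 = 9 * \<beta> * \<bar>\<beta> - 1\<bar> * (1 + 2 / (1 - \<alpha>))"
  have c1: "c1 \<ge> 0" using \<beta> by (simp add: c1_def)
  have "\<bar>(\<Sum>k=n div 2..<n. cell n k) - 2 * \<beta> * Re (zeta (of_real \<alpha>)) * real n powr (\<beta> - 1)\<bar> \<le>
      (c1 * S + c2 + 6 * \<beta>) * real n powr (\<beta> - 2)" if n: "n \<ge> 2" for n
  proof -
    define M where "M = n div 2"
    define N where "N = real n powr (\<beta> - 2)"
    have M: "real n / 3 \<le> real M" "real M \<le> real n / 2" "M < n" "M \<le> n - 1" "M \<ge> 1"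
      using div2_bounds[OF n] n by (auto simp: M_def)
    have "(\<Sum>k=M..<n - 1. real (n - k - 1) powr (- \<alpha> - 1)) = (\<Sum>i<n - 1 - M. real (Suc i) powr (- \<alpha> - 1))"
    proof (rule sum.reindex_bij_witness[of _ "\<lambda>i. n - 2 - i" "\<lambda>k. n - 2 - k"])
      fix k assume "k \<in> {M..<n - 1}"
      then have "Suc (n - 2 - k) = n - k - 1" by auto
      then show "real (Suc (n - 2 - k)) powr (- \<alpha> - 1) = real (n - k - 1) powr (- \<alpha> - 1)"
        by (simp only:)
    qed auto
    also have "\<dots> \<le> S"
      unfolding S_def using \<alpha> by (intro sum_le_suminf summable_Suc_powr) auto
    finally have S: "(\<Sum>k=M..<n - 1. real (n - k - 1) powr (- \<alpha> - 1)) \<le> S" .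
    have "\<bar>\<Sum>k=M..<n - 1. cell n k - p (real n) * \<epsilon> n k\<bar> \<le>
        (\<Sum>k=M..<n - 1. c1 * N * real (n - k - 1) powr (- \<alpha> - 1))"
    proof (rule order_trans[OF sum_abs], rule sum_mono)
      fix k assume "k \<in> {M..<n - 1}"
      then show "\<bar>cell n k - p (real n) * \<epsilon> n k\<bar> \<le> c1 * N * real (n - k - 1) powr (- \<alpha> - 1)"
        unfolding c1_def N_def using n M by (intro cell_right_le) auto
    qed
    also have "\<dots> = c1 * N * (\<Sum>k=M..<n - 1. real (n - k - 1) powr (- \<alpha> - 1))"
      by (simp add: sum_distrib_left)
    also have "\<dots> \<le> c1 * N * S" using S c1 by (intro mult_left_mono) (auto simp: N_def)
    finally have A: "\<bar>\<Sum>k=M..<n - 1. cell n k - p (real n) * \<epsilon> n k\<bar> \<le> c1 * N * S" .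
    have B: "\<bar>cell n (n - 1) - p (real n) * \<epsilon> n (n - 1)\<bar> \<le> c2 * N"
      unfolding c2_def N_def by (rule cell_last_le[OF n])
    have n': "n = Suc (n - 1)" using n by simp
    have "(\<Sum>k=M..<n. cell n k - p (real n) * \<epsilon> n k) =
       (\<Sum>k=M..<n - 1. cell n k - p (real n) * \<epsilon> n k) + (cell n (n - 1) - p (real n) * \<epsilon> n (n - 1))"
      using M(4) sum.atLeastLessThan_Suc[of M "n - 1" "\<lambda>k. cell n k - p (real n) * \<epsilon> n k"] n' by simp
    then have "\<bar>\<Sum>k=M..<n. cell n k - p (real n) * \<epsilon> n k\<bar> \<le> c1 * N * S + c2 * N"
      using A B by linarith
    then have AB: "\<bar>(\<Sum>k=M..<n. cell n k) - p (real n) * (\<Sum>k=M..<n. \<epsilon> n k)\<bar> \<le> c1 * N * S + c2 * N"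
      by (simp add: sum_subtractf sum_distrib_left)
    \<comment> \<open>As n - M \<ge> n/2, the partial sum is within O(1/n) of its limit; the factor
      p(n) = \<beta> n^(\<beta>-1) makes this O(n^(\<beta>-2)).\<close>
    define z where "z = zeta_partial \<alpha> (n - M) - Re (zeta (of_real \<alpha>))"
    have "\<bar>z\<bar> \<le> 3 / 2 * \<bar>\<alpha>\<bar> * real (n - M) powr (- \<alpha> - 1)"
      unfolding z_def using \<alpha> M by (intro zeta_partial_rate) auto
    also have "\<dots> \<le> 3 / 2 * 1 * real (n - M) powr (- 1)"
      using \<alpha> M by (intro mult_mono powr_mono) auto
    also have "real (n - M) powr (- 1) \<le> (real n / 2) powr (- 1)"
      using n M by (intro powr_mono2') (auto simp: of_nat_diff)
    finally have "\<bar>z\<bar> \<le> 3 / real n" using n by (simp add: powr_minus_divide)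
    then have "p (real n) * \<bar>2 * z\<bar> \<le> p (real n) * (6 / real n)"
      using \<beta> by (intro mult_left_mono) (auto simp: p_def abs_mult)
    also have "\<dots> = 6 * \<beta> * N"
      using powr_diff[of "real n" "\<beta> - 1" 1] n by (simp add: p_def N_def)
    finally have Cz: "p (real n) * \<bar>2 * z\<bar> \<le> 6 * \<beta> * N" .
    have p0: "p (real n) \<ge> 0" using \<beta> by (simp add: p_def)
    have "p (real n) * (\<Sum>k=M..<n. \<epsilon> n k) - 2 * \<beta> * Re (zeta (of_real \<alpha>)) * real n powr (\<beta> - 1) = p (real n) * (2 * z)"
      using M by (subst sum_\<epsilon>) (auto simp: z_def p_def algebra_simps)
    then have "\<bar>p (real n) * (\<Sum>k=M..<n. \<epsilon> n k) - 2 * \<beta> * Re (zeta (of_real \<alpha>)) * real n powr (\<beta> - 1)\<bar> \<le> 6 * \<beta> * N"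
      using Cz p0 by (simp add: abs_mult)
    with AB have "\<bar>(\<Sum>k=M..<n. cell n k) - 2 * \<beta> * Re (zeta (of_real \<alpha>)) * real n powr (\<beta> - 1)\<bar> \<le> c1 * N * S + c2 * N + 6 * \<beta> * N"
      by linarith
    then show ?thesis by (simp add: M_def N_def algebra_simps)
  qed
  then show ?thesis by blast
qed

section \<open>The left half for \<beta> \<ge> 1\<close>

text \<open>The weight increases, so the freezing errors are increments of p that telescope, while
  the mean defects are uniformly O(n^(-\<alpha>-2)). The constant is 48 + 8.\<close>

lemma left_half_ge_1:
  assumes "\<beta> \<ge> 1"
  shows "\<exists>C. \<forall>n\<ge>2. \<bar>\<Sum>k<n div 2. cell n k\<bar> \<le> C * real n powr (\<beta> - 2)"
proof -
  have "\<bar>\<Sum>k<n div 2. cell n k\<bar> \<le> (56 * \<beta>) * real n powr (\<beta> - 2)" if n: "n \<ge> 2" for n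
  proof -
    define M where "M = n div 2"
    define A where "A = real n powr (- \<alpha> - 1)"
    have M: "real M \<le> real n / 2" using div2_bounds[OF n] by (simp add: M_def)
    have pmono: "p x \<le> p y" if "0 \<le> x" "x \<le> y" for x y
      unfolding p_def using that assms by (intro mult_left_mono powr_mono2) auto
    have p0: "p x \<ge> 0" for x using \<beta> by (simp add: p_def)
    have cell: "\<bar>cell n k\<bar> \<le> p (real n) * (48 * real n powr (- \<alpha> - 2)) + (p (real (Suc k)) - p (real k)) * (8 * A)"
      if k: "k < M" for k
    proof -
      have d: "real n / 2 \<le> real n - (real k + 1)" using k M by linarith
      have "k < n" using k unfolding M_def by simp
      have "\<bar>cell n k - p (real k) * \<epsilon> n k\<bar> \<le> (p (real (Suc k)) - p (real k)) * (2 * (real n / 2) powr (- \<alpha> - 1))"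
      proof (rule weighted_integral_diff_le[OF has_integral_cell(1) has_integral_v])
        fix x assume x: "real k \<le> x" "x \<le> real k + 1"
        show "\<bar>p x - p (real k)\<bar> \<le> p (real (Suc k)) - p (real k)"
          using pmono[of "real k" x] pmono[of x "real (Suc k)"] x by simp
        show "\<bar>v n k x\<bar> \<le> 2 * (real n / 2) powr (- \<alpha> - 1)"
          using x d n by (intro v_abs_le) auto
      qed (use \<open>k < n\<close> in auto)
      also have "\<dots> \<le> (p (real (Suc k)) - p (real k)) * (2 * (4 * A))"
        using half_powr_le[of "real n" \<alpha> 1] n \<alpha> pmono[of "real k" "real (Suc k)"]
        by (intro mult_left_mono) (auto simp: A_def)
      finally have 1: "\<bar>cell n k - p (real k) * \<epsilon> n k\<bar> \<le> (p (real (Suc k)) - p (real k)) * (8 * A)" by simp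
      have "\<bar>\<epsilon> n k\<bar> \<le> 6 * (real n / 2) powr (- \<alpha> - 2)" using d n by (intro \<epsilon>_abs_le) auto
      also have "\<dots> \<le> 6 * (8 * real n powr (- \<alpha> - 2))"
        using half_powr_le[of "real n" \<alpha> 2] n \<alpha> by (intro mult_left_mono) auto
      finally have "p (real k) * \<bar>\<epsilon> n k\<bar> \<le> p (real n) * (48 * real n powr (- \<alpha> - 2))"
        using p0 pmono[of "real k" "real n"] \<open>k < n\<close> by (intro mult_mono) auto
      then have "\<bar>p (real k) * \<epsilon> n k\<bar> \<le> p (real n) * (48 * real n powr (- \<alpha> - 2))"
        using p0 by (simp add: abs_mult)
      with 1 show ?thesis by linarith
    qed
    have "\<bar>\<Sum>k<M. cell n k\<bar> \<le>
        (\<Sum>k<M. p (real n) * (48 * real n powr (- \<alpha> - 2)) + (p (real (Suc k)) - p (real k)) * (8 * A))"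
      using cell by (intro order_trans[OF sum_abs] sum_mono) auto
    also have "\<dots> = real M * (p (real n) * (48 * real n powr (- \<alpha> - 2))) + (p (real M) - p 0) * (8 * A)"
      using sum_lessThan_telescope[of "\<lambda>k. p (real k)" M]
      by (simp add: sum.distrib sum_distrib_right[symmetric])
    also have "\<dots> \<le> real n * (p (real n) * (48 * real n powr (- \<alpha> - 2))) + p (real n) * (8 * A)"
    proof -
      have "p (real M) \<le> p (real n)" using M by (intro pmono) auto
      then have "p (real M) - p 0 \<le> p (real n)" using p0[of 0] by linarith
      then show ?thesis using M p0 by (intro add_mono mult_right_mono) (auto simp: A_def)
    qed
    also have "real n * (p (real n) * (48 * real n powr (- \<alpha> - 2))) = 48 * p (real n) * A"
      using mult_powr_diff_2[of "real n" "- \<alpha>"] by (simp add: A_def)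
    also have "48 * p (real n) * A + p (real n) * (8 * A) = 56 * (p (real n) * A)" by simp
    also have "p (real n) * A = \<beta> * real n powr (\<beta> - \<alpha> - 2)"
      using powr_add[of "real n" "\<beta> - 1" "- \<alpha> - 1"] by (simp add: p_def A_def algebra_simps)
    also have "56 * (\<beta> * real n powr (\<beta> - \<alpha> - 2)) \<le> 56 * (\<beta> * real n powr (\<beta> - 2))"
      using \<alpha> \<beta> n by (intro mult_left_mono powr_mono) auto
    finally show ?thesis by (simp add: M_def)
  qed
  then show ?thesis by blast
qed

end

section \<open>The left half for \<beta> < 1, and the whole sum\<close>

context power_quadrature
begin

text \<open>In essence an integration by parts: p is the derivative of x^\<beta>, so integrating it
  against the centred linear kernel gives -2 times the trapezoidal error of x^\<beta>.\<close>

lemma has_integral_p_mult_centered: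
  "((\<lambda>x. p x * (2 * real k + 1 - 2 * x)) has_integral
     - 2 * (zeta_partial (- \<beta>) (Suc k) - zeta_partial (- \<beta>) k)) {real k..real k + 1}"
proof -
  have "((\<lambda>x. (2 * real k + 1) * p x - 2 * (p x * x)) has_integral
      ((2 * real k + 1) * ((real k + 1) powr \<beta> - real k powr \<beta>)
       - 2 * (\<beta> * (((real k + 1) powr (\<beta> + 1) - real k powr (\<beta> + 1)) / (\<beta> + 1))))) {real k..real k + 1}"
    by (intro has_integral_diff has_integral_mult_right has_integral_p has_integral_p_mult_id)
  moreover have "(2 * real k + 1) * ((real k + 1) powr \<beta> - real k powr \<beta>)
       - 2 * (\<beta> * (((real k + 1) powr (\<beta> + 1) - real k powr (\<beta> + 1)) / (\<beta> + 1))) =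
     - 2 * (zeta_partial (- \<beta>) (Suc k) - zeta_partial (- \<beta>) k)"
  proof -
    define X where "X = (real k + 1) powr \<beta>"
    define Y where "Y = real k powr \<beta>"
    have XY: "(real k + 1) powr (\<beta> + 1) = X * (real k + 1)" "real k powr (\<beta> + 1) = Y * real k"
      by (auto simp: X_def Y_def powr_add)
    define E where "E = (X * (real k + 1) - Y * real k) / (\<beta> + 1)"
    have b: "\<beta> / (\<beta> + 1) = 1 - 1 / (\<beta> + 1)" using \<beta> by (simp add: field_simps)
    have "\<beta> * ((X * (real k + 1) - Y * real k) / (\<beta> + 1)) =
        (X * (real k + 1) - Y * real k) * (\<beta> / (\<beta> + 1))" by simp
    also have "\<dots> = (X * (real k + 1) - Y * real k) - E"
      unfolding b E_def by (simp add: right_diff_distrib)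
    finally have 1: "\<beta> * ((X * (real k + 1) - Y * real k) / (\<beta> + 1)) =
        (X * (real k + 1) - Y * real k) - E" .
    have 2: "zeta_partial (- \<beta>) (Suc k) - zeta_partial (- \<beta>) k =
        X / 2 + Y / 2 - E"
      using XY by (simp add: zeta_partial_def X_def Y_def E_def add.commute diff_divide_distrib)
    show ?thesis
      unfolding XY 1 2 X_def[symmetric] Y_def[symmetric] by (simp add: algebra_simps)
  qed
  ultimately have "((\<lambda>x. (2 * real k + 1) * p x - 2 * (p x * x)) has_integral
     - 2 * (zeta_partial (- \<beta>) (Suc k) - zeta_partial (- \<beta>) k)) {real k..real k + 1}"
    by (simp only:)
  moreover have "(\<lambda>x. (2 * real k + 1) * p x - 2 * (p x * x)) = (\<lambda>x. p x * (2 * real k + 1 - 2 * x))"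
    by (auto simp: algebra_simps)
  ultimately show ?thesis by simp
qed

text \<open>On the cell x \<le> 2 k and the exponent is at least -1, so p(x) \<ge> p(k)/2;
  integrate. It turns bounds in p(k) into telescoping ones.\<close>

lemma p_le_powr_diff:
  assumes "\<beta> < 1" "k \<ge> 1"
  shows "p (real k) \<le> 2 * ((real k + 1) powr \<beta> - real k powr \<beta>)"
proof -
  have "(1 / 2) * p (real k) \<le> (real k + 1) powr \<beta> - real k powr \<beta>"
  proof (rule has_integral_le[OF _ has_integral_p])
    show "((\<lambda>x. (1 / 2) * p (real k)) has_integral (1 / 2) * p (real k)) {real k..real k + 1}"
      using has_integral_const_real[of "(1 / 2) * p (real k)" "real k" "real k + 1"] by simp
    fix x assume x: "x \<in> {real k..real k + 1}"
    have "(1 / 2) * real k powr (\<beta> - 1) \<le> 2 powr (\<beta> - 1) * real k powr (\<beta> - 1)"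
      using powr_mono[of "-1" "\<beta> - 1" "2::real"] \<beta> by (intro mult_right_mono) (auto simp: powr_minus)
    also have "\<dots> = (2 * real k) powr (\<beta> - 1)" by (simp add: powr_mult)
    also have "\<dots> \<le> x powr (\<beta> - 1)" using x assms by (intro powr_mono2') auto
    finally show "(1 / 2) * p (real k) \<le> p x" using \<beta> by (simp add: p_def)
  qed
  then show ?thesis by simp
qed

text \<open>On the left half \<^term>\<open>q\<close> is linearised at 0. The linear part is summed exactly and yields
  \<open>\<zeta>(-\<beta>)\<close>; in the remainder the oscillating kernel gains a factor \<open>k/n\<close>.\<close>

lemma cell_left_le:
  assumes "\<beta> < 1" "n \<ge> 2" "k < n div 2"
  defines "a \<equiv> \<alpha> * real n powr (- \<alpha> - 1)"
  shows "\<bar>cell n k - a * (- 2 * (zeta_partial (- \<beta>) (Suc k) - zeta_partial (- \<beta>) k))\<bar> \<le>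
    224 * real n powr (- \<alpha> - 2) * ((real k + 1) powr \<beta> - real k powr \<beta>)"
proof -
  define d where "d = real n / 2"
  define N where "N = real n powr (- \<alpha> - 2)"
  \<comment> \<open>The defect annihilates constants, so only the slope of q at 0 is removed. The
    defect of a x is a (2 k + 1 - 2 x), and w is the defect of r.\<close>
  define r where "r = (\<lambda>x. q n x - a * x)"
  define w where "w = (\<lambda>x. v n k x - a * (2 * real k + 1 - 2 * x))"
  define W where "W = cell n k - a * (- 2 * (zeta_partial (- \<beta>) (Suc k) - zeta_partial (- \<beta>) k))"
  define D where "D = (real k + 1) powr \<beta> - real k powr \<beta>"
  have d: "d > 0" "d \<le> real n - (real k + 1)"
    using assms(2,3) div2_bounds[OF assms(2)] by (auto simp: d_def)
  have "k < n" using assms by linarith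
  have N0: "N \<ge> 0" by (simp add: N_def)
  have D0: "D \<ge> 0" unfolding D_def using \<beta> by (auto intro!: powr_mono2)
  have dN: "d powr (- \<alpha> - 2) \<le> 8 * N"
    using half_powr_le[of "real n" \<alpha> 2] assms(2) \<alpha> by (simp add: d_def N_def)
  have "((\<lambda>x. p x * v n k x - a * (p x * (2 * real k + 1 - 2 * x))) has_integral W) {real k..real k + 1}"
    unfolding W_def
    by (intro has_integral_diff has_integral_mult_right has_integral_cell has_integral_p_mult_centered \<open>k < n\<close>)
  moreover have "p x * v n k x - a * (p x * (2 * real k + 1 - 2 * x)) = p x * w x" for x
    by (simp add: w_def algebra_simps)
  ultimately have W: "((\<lambda>x. p x * w x) has_integral W) {real k..real k + 1}" by simp
  \<comment> \<open>The slope of r is q'(z) - q'(0), small because z \<le> k + 1; w consists of two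
    differences of r.\<close>
  have w_le: "\<bar>w x\<bar> \<le> 32 * (real k + 1) * N" if x: "real k \<le> x" "x \<le> real k + 1" for x
  proof -
    have r: "\<bar>r y - r x\<bar> \<le> 16 * (real k + 1) * N" if y: "real k \<le> y" "y \<le> real k + 1" for y
    proof -
      have "norm (r y - r x) \<le> (2 * d powr (- \<alpha> - 2) * (real k + 1)) * norm (y - x)"
      proof (rule field_differentiable_bound[where S = "{real k..real k + 1}"
            and f' = "\<lambda>z. \<alpha> * (real n - z) powr (- \<alpha> - 1) - a"])
        fix z assume z: "z \<in> {real k..real k + 1}"
        show "(r has_real_derivative \<alpha> * (real n - z) powr (- \<alpha> - 1) - a) (at z within {real k..real k + 1})"
          unfolding r_def
          by (rule derivative_eq_intros q_has_derivative | use z d in force)+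
        have "\<bar>\<alpha> * (real n - z) powr (- \<alpha> - 1) - \<alpha> * (real n - 0) powr (- \<alpha> - 1)\<bar> \<le> 2 * d powr (- \<alpha> - 2) * \<bar>z - 0\<bar>"
          using d z by (intro q'_diff_le) auto
        also have "\<dots> \<le> 2 * d powr (- \<alpha> - 2) * (real k + 1)"
          using z by (intro mult_left_mono) auto
        finally show "norm (\<alpha> * (real n - z) powr (- \<alpha> - 1) - a) \<le> 2 * d powr (- \<alpha> - 2) * (real k + 1)"
          by (simp add: a_def)
      qed (use x y in auto)
      also have "\<dots> \<le> (2 * d powr (- \<alpha> - 2) * (real k + 1)) * 1"
        using x y by (intro mult_left_mono) auto
      also have "\<dots> \<le> 2 * (8 * N) * (real k + 1)"
        using dN by simp
      finally show ?thesis by (simp add: mult_ac)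
    qed
    have "w x = (r (real k) - r x) + (r (real k + 1) - r x)"
      by (simp add: w_def r_def v_def algebra_simps)
    then show ?thesis using r[of "real k"] r[of "real k + 1"] by linarith
  qed
  have "\<bar>W\<bar> \<le> 224 * N * D"
  proof (cases "k = 0")
    case True
    \<comment> \<open>The weight may be unbounded near 0 and cannot be frozen there, so the bound on
      w is integrated against p itself.\<close>
    have "\<bar>W\<bar> \<le> (32 * N) * D"
    proof (rule has_integral_abs_le[OF W])
      show "((\<lambda>x. (32 * N) * p x) has_integral (32 * N) * D) {real k..real k + 1}"
        unfolding D_def by (intro has_integral_mult_right has_integral_p)
      fix x assume "real k \<le> x" "x \<le> real k + 1"
      then have "\<bar>w x\<bar> * p x \<le> 32 * N * p x"
        using w_le[of x] True \<beta> by (intro mult_right_mono) (auto simp: p_def)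
      then show "\<bar>p x * w x\<bar> \<le> 32 * N * p x"
        using \<beta> by (simp add: abs_mult p_def mult_ac)
    qed
    also have "\<dots> \<le> 224 * N * D" using N0 D0 by (intro mult_right_mono) auto
    finally show ?thesis .
  next
    case False
    then have k: "k \<ge> 1" by simp
    \<comment> \<open>The linear kernel has mean zero on the cell, so w has the same mean as
      v.\<close>
    have "((\<lambda>x. 2 * real k + 1 - 2 * x) has_integral ((2 * real k + 1) - 2 * (((real k + 1)\<^sup>2 - (real k)\<^sup>2) / 2))) {real k..real k + 1}"
    proof (intro has_integral_diff has_integral_mult_right)
      show "((\<lambda>x. 2 * real k + 1) has_integral (2 * real k + 1)) {real k..real k + 1}"
        using has_integral_const_real[of "2 * real k + 1" "real k" "real k + 1"] by simp
      show "((\<lambda>x. x) has_integral (((real k + 1)\<^sup>2 - (real k)\<^sup>2) / 2)) {real k..real k + 1}"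
        by (rule ident_has_integral) simp
    qed
    moreover have "(2 * real k + 1) - 2 * (((real k + 1)\<^sup>2 - (real k)\<^sup>2) / 2) = 0"
      by (simp add: power2_eq_square field_simps)
    ultimately have "((\<lambda>x. 2 * real k + 1 - 2 * x) has_integral 0) {real k..real k + 1}"
      by (simp only:)
    then have "(w has_integral (\<epsilon> n k - a * 0)) {real k..real k + 1}"
      unfolding w_def by (intro has_integral_diff has_integral_mult_right has_integral_v \<open>k < n\<close>)
    then have w: "(w has_integral \<epsilon> n k) {real k..real k + 1}" by simp
    have "\<bar>W - p (real k) * \<epsilon> n k\<bar> \<le> (\<beta> * real k powr (\<beta> - 2)) * (32 * (real k + 1) * N)"
    proof (rule weighted_integral_diff_le[OF W w _ w_le])
      fix x assume x: "real k \<le> x" "x \<le> real k + 1"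
      have "\<bar>x powr (\<beta> - 1) - real k powr (\<beta> - 1)\<bar> \<le> \<bar>\<beta> - 1\<bar> * real k powr (\<beta> - 1 - 1) * \<bar>x - real k\<bar>"
        using x k assms(1) by (intro powr_diff_le_lower) auto
      also have "\<dots> \<le> 1 * real k powr (\<beta> - 2) * 1"
        using x assms(1) \<beta> by (intro mult_mono) auto
      finally have "\<beta> * \<bar>x powr (\<beta> - 1) - real k powr (\<beta> - 1)\<bar> \<le> \<beta> * real k powr (\<beta> - 2)"
        using \<beta> by simp
      then show "\<bar>p x - p (real k)\<bar> \<le> \<beta> * real k powr (\<beta> - 2)"
        using \<beta> by (simp add: p_def right_diff_distrib[symmetric] abs_mult)
    qed
    \<comment> \<open>As k + 1 \<le> 2 k, the growth of w in k raises k^(\<beta>-2) back to the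
      order of p(k).\<close>
    also have "\<dots> \<le> (\<beta> * real k powr (\<beta> - 2)) * (32 * (2 * real k) * N)"
      using k \<beta> N0 by (intro mult_left_mono mult_right_mono) auto
    also have "\<dots> = 64 * N * p (real k)"
      using mult_powr_diff_2[of "real k" \<beta>] by (simp add: p_def mult_ac)
    finally have 1: "\<bar>W - p (real k) * \<epsilon> n k\<bar> \<le> 64 * N * p (real k)" .
    have p0: "p (real k) \<ge> 0" using \<beta> by (simp add: p_def)
    have "\<bar>\<epsilon> n k\<bar> \<le> 6 * d powr (- \<alpha> - 2)" using d by (rule \<epsilon>_abs_le)
    then have "\<bar>\<epsilon> n k\<bar> \<le> 48 * N" using dN by linarith
    then have "p (real k) * \<bar>\<epsilon> n k\<bar> \<le> p (real k) * (48 * N)" using p0 by (rule mult_left_mono)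
    then have "\<bar>p (real k) * \<epsilon> n k\<bar> \<le> 48 * N * p (real k)" using p0 by (simp add: abs_mult mult_ac)
    with 1 have "\<bar>W\<bar> \<le> 64 * N * p (real k) + 48 * N * p (real k)" by linarith
    also have "\<dots> = 112 * N * p (real k)" by simp
    also have "\<dots> \<le> 112 * N * (2 * D)"
      unfolding D_def using p_le_powr_diff[OF assms(1) k] N0 by (intro mult_left_mono) auto
    finally show ?thesis by simp
  qed
  then show ?thesis by (simp add: W_def N_def D_def)
qed

text \<open>The main parts telescope to the zeta partial sum at -\<beta>, the error bounds to
  M^\<beta> \<le> n^\<beta>. Passing to the limit of the partial sum costs O(n^(\<beta>-1)),
  multiplied by the slope a \<le> 1/n.\<close>

lemma left_half_lt_1:
  assumes "\<beta> < 1"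
  shows "\<exists>C. \<forall>n\<ge>2. \<bar>(\<Sum>k<n div 2. cell n k) + 2 * \<alpha> * Re (zeta (of_real (- \<beta>))) * real n powr (- \<alpha> - 1)\<bar>
     \<le> C * real n powr (\<beta> - 2)"
proof -
  have "\<bar>(\<Sum>k<n div 2. cell n k) + 2 * \<alpha> * Re (zeta (of_real (- \<beta>))) * real n powr (- \<alpha> - 1)\<bar>
     \<le> (224 + 27) * real n powr (\<beta> - 2)" if n: "n \<ge> 2" for n
  proof -
    define M where "M = n div 2"
    define N where "N = real n powr (\<beta> - 2)"
    define a where "a = \<alpha> * real n powr (- \<alpha> - 1)"
    define z where "z = zeta_partial (- \<beta>)"
    have M: "real n / 3 \<le> real M" "real M \<le> real n / 2" "M \<ge> 1"
      using div2_bounds[OF n] n by (auto simp: M_def)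
    have "\<bar>\<Sum>k<M. cell n k - a * (- 2 * (z (Suc k) - z k))\<bar> \<le>
      (\<Sum>k<M. 224 * real n powr (- \<alpha> - 2) * ((real k + 1) powr \<beta> - real k powr \<beta>))"
      using cell_left_le[OF assms n] unfolding a_def z_def M_def
      by (intro order_trans[OF sum_abs] sum_mono) auto
    also have "\<dots> = 224 * real n powr (- \<alpha> - 2) * real M powr \<beta>"
      using sum_lessThan_telescope[of "\<lambda>k. real k powr \<beta>" M]
      by (simp add: sum_distrib_left[symmetric] add.commute)
    also have "\<dots> \<le> 224 * real n powr (- \<alpha> - 2) * real n powr \<beta>"
      using M \<beta> by (intro mult_left_mono powr_mono2) auto
    also have "\<dots> = 224 * real n powr (\<beta> - \<alpha> - 2)"
      by (simp add: powr_add[symmetric] algebra_simps)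
    also have "\<dots> \<le> 224 * N"
      unfolding N_def using n \<alpha> by (intro mult_left_mono powr_mono) auto
    finally have 1: "\<bar>\<Sum>k<M. cell n k - a * (- 2 * (z (Suc k) - z k))\<bar> \<le> 224 * N" .
    have "(\<Sum>k<M. z (Suc k) - z k) = z M"
      unfolding sum_lessThan_telescope by (simp add: z_def zeta_partial_def)
    moreover have "(\<Sum>k<M. cell n k - a * (- 2 * (z (Suc k) - z k))) = (\<Sum>k<M. cell n k + 2 * a * (z (Suc k) - z k))"
      by (intro sum.cong) (auto simp: algebra_simps)
    then have "(\<Sum>k<M. cell n k - a * (- 2 * (z (Suc k) - z k))) = (\<Sum>k<M. cell n k) + 2 * a * (\<Sum>k<M. z (Suc k) - z k)"
      by (simp only: sum.distrib sum_distrib_left)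
    ultimately have 2: "(\<Sum>k<M. cell n k - a * (- 2 * (z (Suc k) - z k))) = (\<Sum>k<M. cell n k) + 2 * a * z M"
      by (simp only:)
    have "\<bar>z M - Re (zeta (of_real (- \<beta>)))\<bar> \<le> 3 / 2 * \<bar>- \<beta>\<bar> * real M powr (- (- \<beta>) - 1)"
      unfolding z_def using \<beta> assms M by (intro zeta_partial_rate) auto
    also have "\<dots> \<le> 3 / 2 * 1 * (9 * real n powr (\<beta> - 1))"
      using powr_le_of_third[of "real n" "real M" "\<beta> - 1"] M n \<beta> assms by (intro mult_mono) auto
    finally have "\<bar>z M - Re (zeta (of_real (- \<beta>)))\<bar> \<le> 27 / 2 * real n powr (\<beta> - 1)" by simp
    moreover have "a \<le> 1 * real n powr (- 1)"
      unfolding a_def using \<alpha> n by (intro mult_mono powr_mono) auto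
    moreover have "a \<ge> 0" using \<alpha> by (simp add: a_def)
    ultimately have "a * \<bar>z M - Re (zeta (of_real (- \<beta>)))\<bar> \<le> (1 * real n powr (- 1)) * (27 / 2 * real n powr (\<beta> - 1))"
      by (intro mult_mono) auto
    also have "\<dots> = 27 / 2 * N"
      using mult_powr_diff_2[of "real n" \<beta>] n by (simp add: N_def field_simps)
    finally have 3: "2 * a * \<bar>z M - Re (zeta (of_real (- \<beta>)))\<bar> \<le> 27 * N" by simp
    have "\<bar>2 * a * (z M - Re (zeta (of_real (- \<beta>))))\<bar> \<le> 27 * N"
      using 3 \<open>a \<ge> 0\<close> by (simp add: abs_mult)
    moreover have "(\<Sum>k<M. cell n k) + 2 * a * Re (zeta (of_real (- \<beta>))) =
       ((\<Sum>k<M. cell n k) + 2 * a * z M) - 2 * a * (z M - Re (zeta (of_real (- \<beta>))))"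
      by (simp add: algebra_simps)
    ultimately have "\<bar>(\<Sum>k<M. cell n k) + 2 * a * Re (zeta (of_real (- \<beta>)))\<bar> \<le> 224 * N + 27 * N"
      using 1 unfolding 2 by linarith
    then show ?thesis by (simp add: M_def N_def a_def mult_ac)
  qed
  then show ?thesis by blast
qed

lemma sum_cell_asymptotics:
  "\<exists>C. \<forall>n\<ge>2. \<bar>(\<Sum>k<n. cell n k) - 2 * \<beta> * Re (zeta (of_real \<alpha>)) * real n powr (\<beta> - 1)
      + 2 * \<alpha> * Re (zeta (of_real (- \<beta>))) * real n powr (- \<alpha> - 1)\<bar> \<le> C * real n powr (\<beta> - 2)"
proof -
  obtain C1 where C1: "\<And>n. n \<ge> 2 \<Longrightarrow>
     \<bar>(\<Sum>k=n div 2..<n. cell n k) - 2 * \<beta> * Re (zeta (of_real \<alpha>)) * real n powr (\<beta> - 1)\<bar> \<le> C1 * real n powr (\<beta> - 2)"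
    using right_half by blast
  obtain C2 where C2: "\<And>n. n \<ge> 2 \<Longrightarrow>
     \<bar>(\<Sum>k<n div 2. cell n k) + 2 * \<alpha> * Re (zeta (of_real (- \<beta>))) * real n powr (- \<alpha> - 1)\<bar> \<le> C2 * real n powr (\<beta> - 2)"
  proof (cases "\<beta> < 1")
    case True
    then show ?thesis using left_half_lt_1 that by blast
  next
    case False
    then obtain C where C: "\<And>n. n \<ge> 2 \<Longrightarrow> \<bar>\<Sum>k<n div 2. cell n k\<bar> \<le> C * real n powr (\<beta> - 2)"
      using left_half_ge_1 by force
    define K where "K = 2 * \<alpha> * Re (zeta (of_real (- \<beta>)))"
    show ?thesis
    proof (rule that[of "C + \<bar>K\<bar>"])
      fix n :: nat assume n: "n \<ge> 2"
      \<comment> \<open>For \<beta> \<ge> 1 one has -\<alpha> - 1 < -1 \<le> \<beta> - 2, so the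
        zeta term may be added at the price of a larger constant.\<close>
      have "\<bar>K * real n powr (- \<alpha> - 1)\<bar> \<le> \<bar>K\<bar> * real n powr (\<beta> - 2)"
        using n False \<alpha> by (simp add: abs_mult mult_left_mono powr_mono)
      then show "\<bar>(\<Sum>k<n div 2. cell n k) + 2 * \<alpha> * Re (zeta (of_real (- \<beta>))) * real n powr (- \<alpha> - 1)\<bar>
          \<le> (C + \<bar>K\<bar>) * real n powr (\<beta> - 2)"
        using C[OF n] unfolding K_def[symmetric] distrib_right by linarith
    qed
  qed
  show ?thesis
  proof (intro exI[of _ "C1 + C2"] allI impI)
    fix n :: nat assume n: "n \<ge> 2"
    have "(\<Sum>k<n. cell n k) = (\<Sum>k<n div 2. cell n k) + (\<Sum>k=n div 2..<n. cell n k)"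
      unfolding lessThan_atLeast0 by (rule sum.atLeastLessThan_concat[symmetric]) auto
    then show "\<bar>(\<Sum>k<n. cell n k) - 2 * \<beta> * Re (zeta (of_real \<alpha>)) * real n powr (\<beta> - 1)
      + 2 * \<alpha> * Re (zeta (of_real (- \<beta>))) * real n powr (- \<alpha> - 1)\<bar> \<le> (C1 + C2) * real n powr (\<beta> - 2)"
      using C1[OF n] C2[OF n] unfolding distrib_right by linarith
  qed
qed

end

section \<open>Summation by parts, the Caputo derivative and the conclusion\<close>

lemma sum_by_parts_centered:
  fixes g c :: "nat \<Rightarrow> real"
  assumes "g 0 = 0"
  shows "(\<Sum>i<Suc m. (g (Suc i) + g i) * (c i - c (Suc i))) =
    g 1 * c 0 + (\<Sum>i=1..m. (g (i + 1) - g (i - 1)) * c i) - (g (Suc m) + g m) * c (Suc m)"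
  by (induction m) (auto simp: assms algebra_simps)

text \<open>Counting cells from the right end and summing by parts moves the differences from the
  powers k^\<beta> onto the kernel, which produces the centred differences of the claim.\<close>

lemma (in power_quadrature) trapezoid_sum_eq:
  assumes "n \<ge> 2"
  shows "(\<Sum>k<n. (q n (real k) + q n (real k + 1)) * ((real k + 1) powr \<beta> - real k powr \<beta>)) =
    real n powr \<beta> + real (n - 1) powr \<beta> / 2 powr \<alpha> +
    (\<Sum>k=2..n - 1. (1 / real (k + 1) powr \<alpha> - 1 / real (k - 1) powr \<alpha>) * real (n - k) powr \<beta>)"
proof -
  define g where "g = (\<lambda>j::nat. real j powr (- \<alpha>))"
  define c where "c = (\<lambda>i. real (n - i) powr \<beta>)"
  obtain m where m: "n = Suc (Suc m)" using assms by (metis Suc_le_D numeral_2_eq_2 Suc_le_mono)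
  have "(\<Sum>k<n. (q n (real k) + q n (real k + 1)) * ((real k + 1) powr \<beta> - real k powr \<beta>)) =
     (\<Sum>i<n. (g (Suc i) + g i) * (c i - c (Suc i)))"
  proof (rule sum.reindex_bij_witness[of _ "\<lambda>i. n - 1 - i" "\<lambda>k. n - 1 - k"])
    fix k assume k: "k \<in> {..<n}"
    then have e: "real n - real k = real (Suc (n - 1 - k))" "real n - (real k + 1) = real (n - 1 - k)"
      "n - (n - 1 - k) = Suc k" "n - Suc (n - 1 - k) = k" "real k + 1 = real (Suc k)"
      by (auto simp: of_nat_diff)
    show "(g (Suc (n - 1 - k)) + g (n - 1 - k)) * (c (n - 1 - k) - c (Suc (n - 1 - k))) =
      (q n (real k) + q n (real k + 1)) * ((real k + 1) powr \<beta> - real k powr \<beta>)"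
      unfolding g_def c_def q_def e(1-4) unfolding e(5) ..
  qed (use assms in auto)
  also have "\<dots> = g 1 * c 0 + (\<Sum>i=1..Suc m. (g (i + 1) - g (i - 1)) * c i) - (g n + g (Suc m)) * c n"
    unfolding m by (rule sum_by_parts_centered) (simp add: g_def)
  \<comment> \<open>The upper boundary term drops out because c n is a power of 0.\<close>
  also have "\<dots> = real n powr \<beta> + (\<Sum>i=1..n - 1. (g (i + 1) - g (i - 1)) * c i)"
    by (simp add: g_def c_def m)
  also have "(\<Sum>i=1..n - 1. (g (i + 1) - g (i - 1)) * c i) =
      (g 2 - g 0) * c 1 + (\<Sum>i=2..n - 1. (g (i + 1) - g (i - 1)) * c i)"
    using assms by (subst sum.atLeast_Suc_atMost) (auto simp: numeral_2_eq_2)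
  also have "(g 2 - g 0) * c 1 = real (n - 1) powr \<beta> / 2 powr \<alpha>"
    by (simp add: g_def c_def powr_minus_divide)
  finally show ?thesis by (simp add: g_def c_def powr_minus_divide)
qed

text \<open>The value is left as a Beta function, the form in which it cancels against
  \<open>sum_cell\<close>. The point 0, where the derivative may be unspecified, is removed as a
  finite exceptional set.\<close>

lemma caputo_powr:
  assumes "\<beta> > 0" "\<alpha> < 1" "t > 0"
  shows "caputo \<alpha> (\<lambda>x. x powr \<beta>) t = 1 / Gamma (1 - \<alpha>) * (\<beta> * Beta \<beta> (1 - \<alpha>) * t powr (\<beta> - \<alpha>))"
proof -
  have "((\<lambda>x. \<beta> * (x powr (\<beta> - 1) * (t - x) powr (1 - \<alpha> - 1))) has_integral
      \<beta> * (t powr (\<beta> + (1 - \<alpha>) - 1) * Beta \<beta> (1 - \<alpha>))) {0..t}"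
    using assms by (intro has_integral_mult_right has_integral_Beta_scaled) auto
  then have "((\<lambda>x. deriv (\<lambda>x. x powr \<beta>) x / (t - x) powr \<alpha>) has_integral
      \<beta> * (t powr (\<beta> + (1 - \<alpha>) - 1) * Beta \<beta> (1 - \<alpha>))) {0..t}"
  proof (rule has_integral_spike_finite[rotated 2])
    fix x assume "x \<in> {0..t} - {0}"
    then have "((\<lambda>x. x powr \<beta>) has_real_derivative \<beta> * x powr (\<beta> - 1)) (at x)"
      by (auto intro!: derivative_eq_intros)
    then have "deriv (\<lambda>x. x powr \<beta>) x = \<beta> * x powr (\<beta> - 1)" by (rule DERIV_imp_deriv)
    then show "deriv (\<lambda>x. x powr \<beta>) x / (t - x) powr \<alpha> = \<beta> * (x powr (\<beta> - 1) * (t - x) powr (1 - \<alpha> - 1))"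
      by (simp add: powr_minus_divide)
  qed auto
  then have "integral {0..t} (\<lambda>x. deriv (\<lambda>x. x powr \<beta>) x / (t - x) powr \<alpha>) =
      \<beta> * (t powr (\<beta> + (1 - \<alpha>) - 1) * Beta \<beta> (1 - \<alpha>))"
    by (rule integral_unique)
  then show ?thesis unfolding caputo_def by (simp add: mult_ac)
qed

theorem claim7:
  fixes \<alpha> \<beta> t :: real and y :: "real \<Rightarrow> real" and h :: "nat \<Rightarrow> real"
  assumes "0 < \<alpha>" and "\<alpha> < 1" and "\<beta> > 0" and "t > 0"
    and "y = (\<lambda>x. x powr \<beta>)"
    and "h = (\<lambda>n. t / real n)"
  shows "(\<lambda>n.
      1 / (2 * Gamma (1 - \<alpha>) * h n powr \<alpha>) *
        (y (real n * h n) + y (real (n - 1) * h n) / 2 powr \<alpha> +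
         (\<Sum>k = 2..n - 1. (1 / real (k + 1) powr \<alpha> - 1 / real (k - 1) powr \<alpha>) *
            y (real (n - k) * h n)))
      - (caputo \<alpha> y t
         + Re (zeta (of_real \<alpha>)) / Gamma (1 - \<alpha>) * deriv y t * h n powr (1 - \<alpha>)
         + Re (zeta (of_real (- \<beta>))) / (Gamma (- \<alpha>) * t powr (1 + \<alpha>)) * h n powr (1 + \<beta>)))
    \<in> O[sequentially](\<lambda>n. h n powr (2 - \<alpha>))"
proof -
  interpret power_quadrature \<alpha> \<beta> using assms by unfold_locales auto
  define G where "G = Gamma (1 - \<alpha>)"
  define z1 where "z1 = Re (zeta (of_real \<alpha>))"
  define z2 where "z2 = Re (zeta (of_real (- \<beta>)))"
  have G: "G > 0" unfolding G_def using assms by (intro Gamma_real_pos) simp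
  have "- \<alpha> \<notin> \<int>\<^sub>\<le>\<^sub>0"
  proof
    assume "- \<alpha> \<in> \<int>\<^sub>\<le>\<^sub>0"
    then obtain m where "- \<alpha> = - of_nat m" by (rule nonpos_Ints_cases')
    then show False using assms by (cases m) auto
  qed
  \<comment> \<open>Converts the factor \<alpha> and the sign in the cell asymptotics into the 1 /
    Gamma(-\<alpha>) of the claim.\<close>
  then have "Gamma (- \<alpha> + 1) = - \<alpha> * Gamma (- \<alpha>)" by (rule Gamma_plus1)
  then have G': "Gamma (- \<alpha>) = - G / \<alpha>" using assms by (simp add: G_def field_simps)
  have "((\<lambda>x. x powr \<beta>) has_real_derivative \<beta> * t powr (\<beta> - 1)) (at t)"
    using assms by (auto intro!: derivative_eq_intros)
  then have dy: "deriv y t = \<beta> * t powr (\<beta> - 1)"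
    unfolding assms(5) by (rule DERIV_imp_deriv)
  obtain C where C: "\<And>n. n \<ge> 2 \<Longrightarrow> \<bar>(\<Sum>k<n. cell n k) - 2 * \<beta> * z1 * real n powr (\<beta> - 1)
      + 2 * \<alpha> * z2 * real n powr (- \<alpha> - 1)\<bar> \<le> C * real n powr (\<beta> - 2)"
    using sum_cell_asymptotics unfolding z1_def z2_def by blast
  \<comment> \<open>An exact identity: since n h = t, every term carries the factor
    h^(\<beta>-\<alpha>) / (2 G), and the Beta integral cancels the Caputo derivative.\<close>
  have main: "1 / (2 * Gamma (1 - \<alpha>) * h n powr \<alpha>) *
        (y (real n * h n) + y (real (n - 1) * h n) / 2 powr \<alpha> +
         (\<Sum>k = 2..n - 1. (1 / real (k + 1) powr \<alpha> - 1 / real (k - 1) powr \<alpha>) *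
            y (real (n - k) * h n)))
      - (caputo \<alpha> y t
         + Re (zeta (of_real \<alpha>)) / Gamma (1 - \<alpha>) * deriv y t * h n powr (1 - \<alpha>)
         + Re (zeta (of_real (- \<beta>))) / (Gamma (- \<alpha>) * t powr (1 + \<alpha>)) * h n powr (1 + \<beta>)) =
     h n powr (\<beta> - \<alpha>) / (2 * G) * ((\<Sum>k<n. cell n k) - 2 * \<beta> * z1 * real n powr (\<beta> - 1)
      + 2 * \<alpha> * z2 * real n powr (- \<alpha> - 1))" if n: "n \<ge> 2" for n
  proof -
    define x where "x = h n"
    have x: "x > 0" "t = real n * x" using n assms by (auto simp: x_def)
    have nn: "real n > 0" using n by simp
    define T where "T = real n powr \<beta> + real (n - 1) powr \<beta> / 2 powr \<alpha> +
      (\<Sum>k=2..n - 1. (1 / real (k + 1) powr \<alpha> - 1 / real (k - 1) powr \<alpha>) * real (n - k) powr \<beta>)"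
    have T: "T = (\<Sum>k<n. cell n k) + 2 * (\<beta> * Beta \<beta> (1 - \<alpha>) * real n powr (\<beta> - \<alpha>))"
      using sum_cell[of n] trapezoid_sum_eq[OF n] n by (simp add: T_def)
    have "y (real n * h n) + y (real (n - 1) * h n) / 2 powr \<alpha> +
         (\<Sum>k = 2..n - 1. (1 / real (k + 1) powr \<alpha> - 1 / real (k - 1) powr \<alpha>) *
            y (real (n - k) * h n)) = x powr \<beta> * T"
      unfolding assms(5) T_def x_def[symmetric] using x
      by (simp add: powr_mult distrib_left sum_distrib_left mult_ac)
    then have 1: "1 / (2 * Gamma (1 - \<alpha>) * h n powr \<alpha>) *
        (y (real n * h n) + y (real (n - 1) * h n) / 2 powr \<alpha> +
         (\<Sum>k = 2..n - 1. (1 / real (k + 1) powr \<alpha> - 1 / real (k - 1) powr \<alpha>) *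
            y (real (n - k) * h n))) = x powr (\<beta> - \<alpha>) / (2 * G) * T"
      using x by (simp add: G_def x_def[symmetric] powr_diff)
    have 2: "caputo \<alpha> y t = x powr (\<beta> - \<alpha>) / (2 * G) * (2 * (\<beta> * Beta \<beta> (1 - \<alpha>) * real n powr (\<beta> - \<alpha>)))"
      unfolding assms(5) caputo_powr[OF assms(3,2,4)] using x G
      by (simp add: G_def powr_mult)
    have "t powr (\<beta> - 1) * x powr (1 - \<alpha>) = real n powr (\<beta> - 1) * x powr (\<beta> - \<alpha>)"
      using x by (simp add: powr_mult powr_add[symmetric])
    then have 3: "Re (zeta (of_real \<alpha>)) / Gamma (1 - \<alpha>) * deriv y t * h n powr (1 - \<alpha>) =
       x powr (\<beta> - \<alpha>) / (2 * G) * (2 * \<beta> * z1 * real n powr (\<beta> - 1))"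
      using G unfolding dy z1_def[symmetric] G_def[symmetric] x_def[symmetric] by simp
    have "x powr (1 + \<beta>) / t powr (1 + \<alpha>) = x powr (\<beta> - \<alpha>) * real n powr (- \<alpha> - 1)"
    proof -
      have "x powr (1 + \<beta>) = x powr (\<beta> - \<alpha>) * x powr (1 + \<alpha>)" by (simp add: powr_add[symmetric] add.commute)
      moreover have "real n powr (- \<alpha> - 1) = real n powr (- (1 + \<alpha>))"
        by (rule arg_cong[where f = "\<lambda>c. real n powr c"]) simp
      then have "real n powr (- \<alpha> - 1) = 1 / real n powr (1 + \<alpha>)"
        unfolding powr_minus_divide .
      ultimately show ?thesis using x by (simp add: powr_mult)
    qed
    moreover have "z2 / (- G / \<alpha> * t powr (1 + \<alpha>)) * x powr (1 + \<beta>) = - (\<alpha> * z2 / G) * (x powr (1 + \<beta>) / t powr (1 + \<alpha>))"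
      using assms(1) by simp
    ultimately have 4: "Re (zeta (of_real (- \<beta>))) / (Gamma (- \<alpha>) * t powr (1 + \<alpha>)) * h n powr (1 + \<beta>) =
       - (x powr (\<beta> - \<alpha>) / (2 * G) * (2 * \<alpha> * z2 * real n powr (- \<alpha> - 1)))"
      using G assms(1) unfolding G' z2_def[symmetric] x_def[symmetric] by simp
    show ?thesis unfolding 1 2 3 4 unfolding T x_def[symmetric] by (simp add: algebra_simps)
  qed
  show ?thesis
  proof (rule bigoI[of _ "t powr (\<beta> - 2) / (2 * G) * C"], rule eventually_sequentiallyI[of 2])
    fix n :: nat assume n: "n \<ge> 2"
    have x: "h n > 0" "real n = t / h n" using n assms by auto
    \<comment> \<open>With n = t/h the error of order n^(\<beta>-2) becomes h^(2-\<alpha>) up to a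
      factor fixed by t and \<beta>.\<close>
    have "h n powr (\<beta> - \<alpha>) * real n powr (\<beta> - 2) = t powr (\<beta> - 2) * h n powr (2 - \<alpha>)"
      unfolding x(2) using x(1) assms(4) by (simp add: powr_divide powr_diff powr_add field_simps)
    moreover have "\<bar>h n powr (\<beta> - \<alpha>) / (2 * G) * ((\<Sum>k<n. cell n k) - 2 * \<beta> * z1 * real n powr (\<beta> - 1)
      + 2 * \<alpha> * z2 * real n powr (- \<alpha> - 1))\<bar> \<le> h n powr (\<beta> - \<alpha>) / (2 * G) * (C * real n powr (\<beta> - 2))"
      using C[OF n] G unfolding abs_mult by (intro mult_mono) auto
    ultimately show "norm (1 / (2 * Gamma (1 - \<alpha>) * h n powr \<alpha>) *
        (y (real n * h n) + y (real (n - 1) * h n) / 2 powr \<alpha> +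
         (\<Sum>k = 2..n - 1. (1 / real (k + 1) powr \<alpha> - 1 / real (k - 1) powr \<alpha>) *
            y (real (n - k) * h n)))
      - (caputo \<alpha> y t
         + Re (zeta (of_real \<alpha>)) / Gamma (1 - \<alpha>) * deriv y t * h n powr (1 - \<alpha>)
         + Re (zeta (of_real (- \<beta>))) / (Gamma (- \<alpha>) * t powr (1 + \<alpha>)) * h n powr (1 + \<beta>)))
      \<le> t powr (\<beta> - 2) / (2 * G) * C * norm (h n powr (2 - \<alpha>))"
      unfolding main[OF n] by (simp add: mult_ac)
  qed
qed

end
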